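(* Let $j\ge 0$ be an integer. The maps $\Phi_j,\Psi_j,\Gamma_j,\Gamma_j^{-1},\Lambda$ described in the context are well defined (in particular the iterations defining $\Phi_j$ and $\Psi_j$ terminate), and the composition $\Lambda\circ\Gamma_j\circ\Phi_j$ is a weight-preserving bijection from the set of partitions of weight greater than $1$ in $\mathcal{M}_j\cap\overline{\mathcal{P}}_j$ to the set of partitions of weight greater than $1$ with crank at least $j$; its inverse is $\Psi_j\circ\Gamma_j^{-1}\circ\Lambda$.
   Context: **Basics.** A partition is a finite non-increasing sequence $\lambda=(\lambda_1,\dots,\lambda_s)$ of positive integers (possibly empty), $\ell(\lambda)=s$, $|\lambda|=\sum_i\lambda_i$ is its weight; by convention $\lambda_0=\infty$ and $\lambda_{\ell(\lambda)+1}=0$. $\mathcal{P}$ is the set of all partitions and $\overline{\mathcal{A}}$ denotes the complement in $\mathcal{P}$ of $\mathcal{A}\subset\mathcal{P}$. For $m\ge1$, $\mathcal{P}_m$ is the set of partitions not having $m$ as a part, so $\overline{\mathcal{P}}_m$ is the set of partitions having $m$ as a part; by the convention $\lambda_{\ell(\lambda)+1}=0$, $\overline{\mathcal{P}}_0=\mathcal{P}$. $mex_j(\lambda)$ is the smallest integer greater than $j$ that is not a part of $\lambda$; $\mathcal{M}_j$ is the set of partitions with $mex_j(\lambda)-j$ odd. For $m\ge0$, $d_m^\lambda=\max\{i\in\{0,\dots,\ell(\lambda)\}:\lambda_i-i\ge m\}$, and $\mathcal{F}_m$ is the set of partitions with $m\notin\{\lambda_i-i:1\le i\le\ell(\lambda)\}$;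 thus $\lambda\in\overline{\mathcal{F}}_m$ iff $\lambda_{d_m^\lambda}=d_m^\lambda+m$. **Crank.** $\omega(\lambda)$ is the number of parts equal to $1$, $\eta(\lambda)$ the number of parts greater than $\omega(\lambda)$; $crank(\lambda)=\lambda_1$ if $\omega(\lambda)=0$ and $\lambda\ne\emptyset$, $crank(\lambda)=\eta(\lambda)-\omega(\lambda)$ if $\omega(\lambda)>0$, and $crank(\emptyset)=0$. **The maps $\phi_j$ and $\Phi_j$.** Let $\Delta_{j,k}=(j+k,j+k-1,\dots,j+1)$, $\Delta_{j,0}=\emptyset$. The map $\phi_j$ is defined on all pairs $(\Delta_{j,2k},\lambda)$, $k\ge0$, $\lambda\in\mathcal{P}$, not in $\{\Delta_{j,0}\}\times\mathcal{F}_j$. Write $d=d_{j+2k}^\lambda$. (1) If $k\ge0$ and $\lambda\in\overline{\mathcal{F}}_{j+2k}$: delete from $\lambda$ the part $\lambda_d=d+j+2k$, add $1$ to each of the parts $\lambda_1,\dots,\lambda_{d-1}$, and insert a part $1+j+2k$, giving $\mu$; $\phi_j((\Delta_{j,2k},\lambda))=(\Delta_{j,2k},\mu)$. (2) If $k\ge1$ and $\lambda\in\mathcal{F}_{j+2k}$: subtract $1$ from each of $\lambda_1,\dots,\lambda_d$ and insert the parts $d+j+2k$ and $j+2k-1$, giving $\mu$; $\phi_j((\Delta_{j,2k},\lambda))=(\Delta_{j,2k-2},\mu)$. Identify $\lambda\in\mathcal{M}_j$ with the pair $(\Delta_{j,2k},\mu)$, where $mex_j(\lambda)=j+2k+1$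 and $\mu\in\mathcal{P}_{j+2k+1}$ is $\lambda$ with one copy of each of $j+1,\dots,j+2k$ removed; identify $\nu\in\mathcal{F}_j$ with $(\Delta_{j,0},\nu)$. $\Phi_j:\mathcal{M}_j\to\mathcal{F}_j$ is obtained, through these identifications, by iterating $\phi_j$ starting from the pair of $\lambda$ until a pair in $\{\Delta_{j,0}\}\times\mathcal{F}_j$ is reached (zero iterations being allowed). **The maps $\psi_j$ and $\Psi_j$.** $\psi_j$ is defined on all pairs $(\Delta_{j,2k},\mu)$ with $k\ge0$, $\mu\in\overline{\mathcal{P}}_{j+2k+1}$. Write $d=d_{1+j+2k}^\mu$. (1) If $\mu\in\overline{\mathcal{F}}_{j+2k+1}$: add $1$ to each of $\mu_1,\dots,\mu_{d-1}$ and delete the part $\mu_d=d+1+j+2k$ and one part $1+j+2k$, giving $\lambda$; $\psi_j((\Delta_{j,2k},\mu))=(\Delta_{j,2k+2},\lambda)$. (2) If $\mu\in\mathcal{F}_{j+2k+1}$: delete one part $1+j+2k$, subtract $1$ from each of $\mu_1,\dots,\mu_d$, and insert a part $d+1+j+2k$, giving $\lambda$; $\psi_j((\Delta_{j,2k},\mu))=(\Delta_{j,2k},\lambda)$. $\Psi_j:\mathcal{F}_j\to\mathcal{M}_j$ is obtained, through the same identifications, by iterating $\psi_j$ from $(\Delta_{j,0},\mu)$ until a pair in $\bigsqcup_{k\ge0}\{\Delta_{j,2k}\}\times\mathcal{P}_{j+2k+1}$ is reached (zero iterations being allowed). **The maps $\Gamma_j$ and $\Gamma_j^{-1}$.** For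 $\lambda\in\mathcal{F}_j\cap\overline{\mathcal{P}}_j$ with $|\lambda|>1$ and $d=d_j^\lambda$, $\Gamma_j(\lambda)$ is obtained by subtracting $1$ from each of $\lambda_1,\dots,\lambda_d$, deleting one part $j$ (nothing is deleted if $j=0$), and inserting $d+j$ parts equal to $1$. For $\mu$ with $crank(\mu)\le -j$, $|\mu|>1$ and $d=d_j^\mu$, $\Gamma_j^{-1}(\mu)$ is obtained by deleting the last $d+j$ parts of $\mu$ (which are all equal to $1$), adding $1$ to each of $\mu_1,\dots,\mu_d$, and inserting a part $j$ (nothing is inserted if $j=0$). **The map $\Lambda$.** For $\lambda$ with $|\lambda|>1$, $\nu=\Lambda(\lambda)$ is as follows. If $\omega(\lambda)=0$: delete the part $\lambda_1$ and insert $\lambda_1$ parts equal to $1$. If $\omega(\lambda)>0$ and $\eta(\lambda)=0$: delete all $\omega(\lambda)$ parts equal to $1$ and insert a part $\omega(\lambda)$ as the first part. If $\omega(\lambda),\eta(\lambda)>0$: let $\rho=\max\{\omega(\lambda),\lambda_2-1\}$ and let $\lambda^*$ be the conjugate partition, $\lambda^*_i=\#\{u:\lambda_u\ge i\}$; set $\nu_1=\lambda_2^*+\lambda_1-\rho$, $\nu_i=1+\lambda_i^*$ for $2\le i\le\omega(\lambda)$, $\nu_i=\lambda_{i+1}^*$ for $\omega(\lambda)<i\le\rho$ , and $\nu_i=1$ for $\rho<i\le\rho+\eta(\lambda)$. *)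

theory Defs
  imports Main "HOL-Library.While_Combinator"
begin

definition partitions :: "nat list set" where
  "partitions = {p. sorted_wrt (\<ge>) p \<and> 0 \<notin> set p}"

abbreviation weight :: "nat list \<Rightarrow> nat" where
  "weight p \<equiv> sum_list p"

text \<open>Parts are numbered from 1, and the part with index one more than the length is 0.
  The convention that the part with index 0 is infinite is built into \<open>durfee\<close> below.\<close>
definition part :: "nat list \<Rightarrow> nat \<Rightarrow> nat" where
  "part p i = (if 1 \<le> i \<and> i \<le> length p then p ! (i - 1) else 0)"

text \<open>\<open>with_part m\<close> is the complement of \<open>\<P>\<^sub>m\<close>; every partition has 0 as a part, by convention.\<close>
definition with_part :: "nat \<Rightarrow> nat list set" where
  "with_part m = {p \<in> partitions. m = 0 \<or> m \<in> set p}"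

definition mex :: "nat \<Rightarrow> nat list \<Rightarrow> nat" where
  "mex j p = (LEAST m. j < m \<and> m \<notin> set p)"

definition odd_mex :: "nat \<Rightarrow> nat list set" where
  "odd_mex j = {p \<in> partitions. odd (mex j p - j)}"

text \<open>\<open>durfee m p\<close> and \<open>fixfree m\<close> are \<open>d\<^sub>m\<close> and \<open>\<F>\<^sub>m\<close>.\<close>
definition durfee :: "nat \<Rightarrow> nat list \<Rightarrow> nat" where
  "durfee m p = Max {i. i \<le> length p \<and> (i = 0 \<or> int (part p i) - int i \<ge> int m)}"

definition fixfree :: "nat \<Rightarrow> nat list set" where
  "fixfree m = {p \<in> partitions. int m \<notin> {int (part p i) - int i | i. 1 \<le> i \<and> i \<le> length p}}"

definition num_ones :: "nat list \<Rightarrow> nat" where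
  "num_ones p = count_list p 1"

definition num_large :: "nat list \<Rightarrow> nat" where
  "num_large p = length (filter (\<lambda>x. x > num_ones p) p)"

definition crank :: "nat list \<Rightarrow> int" where
  "crank p =
    (if p = [] then 0
     else if num_ones p = 0 then int (part p 1)
     else int (num_large p) - int (num_ones p))"

definition conj_part :: "nat list \<Rightarrow> nat \<Rightarrow> nat" where
  "conj_part p i = card {u. 1 \<le> u \<and> u \<le> length p \<and> part p u \<ge> i}"

definition insert_parts :: "nat list \<Rightarrow> nat list \<Rightarrow> nat list" where
  "insert_parts qs p = rev (sort (qs @ p))"

definition Delta :: "nat \<Rightarrow> nat \<Rightarrow> nat list" where
  "Delta j k = rev [j + 1..<j + k + 1]"

text \<open>A pair \<open>(\<Delta>\<^bsub>j,2k\<^esub>, p)\<close> is represented by \<open>(k, p)\<close>. The next two functions are the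
  identification of \<open>\<M>\<^sub>j\<close> with a set of such pairs, and its inverse.\<close>
definition to_pair :: "nat \<Rightarrow> nat list \<Rightarrow> nat \<times> nat list" where
  "to_pair j p =
    (let k = (mex j p - j - 1) div 2 in (k, fold remove1 (Delta j (2 * k)) p))"

fun from_pair :: "nat \<Rightarrow> nat \<times> nat list \<Rightarrow> nat list" where
  "from_pair j (k, p) = insert_parts (Delta j (2 * k)) p"

definition phi :: "nat \<Rightarrow> nat \<times> nat list \<Rightarrow> nat \<times> nat list" where
  "phi j = (\<lambda>(k, p). let m = j + 2 * k; d = durfee m p in
     if p \<notin> fixfree m
     then (k, insert_parts [1 + m] (map (\<lambda>x. x + 1) (take (d - 1) p) @ drop d p))
     else (k - 1, insert_parts [d + m, m - 1] (map (\<lambda>x. x - 1) (take d p) @ drop d p)))"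

text \<open>The value \<open>None\<close> of \<open>while_option\<close> means that the iteration does not terminate.\<close>
definition Phi_run :: "nat \<Rightarrow> nat list \<Rightarrow> (nat \<times> nat list) option" where
  "Phi_run j p = while_option (\<lambda>(k, q). \<not> (k = 0 \<and> q \<in> fixfree j)) (phi j) (to_pair j p)"

definition Phi :: "nat \<Rightarrow> nat list \<Rightarrow> nat list" where
  "Phi j p = snd (the (Phi_run j p))"

definition psi :: "nat \<Rightarrow> nat \<times> nat list \<Rightarrow> nat \<times> nat list" where
  "psi j = (\<lambda>(k, p). let m = j + 2 * k + 1; d = durfee m p in
     if p \<notin> fixfree m
     then (k + 1, map (\<lambda>x. x + 1) (take (d - 1) p) @ remove1 m (drop d p))
     else (k, insert_parts [d + m] (map (\<lambda>x. x - 1) (take d p) @ remove1 m (drop d p))))"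

definition Psi_run :: "nat \<Rightarrow> nat list \<Rightarrow> (nat \<times> nat list) option" where
  "Psi_run j p = while_option (\<lambda>(k, q). q \<in> with_part (j + 2 * k + 1)) (psi j) (0, p)"

definition Psi :: "nat \<Rightarrow> nat list \<Rightarrow> nat list" where
  "Psi j p = from_pair j (the (Psi_run j p))"

definition Gam :: "nat \<Rightarrow> nat list \<Rightarrow> nat list" where
  "Gam j p = (let d = durfee j p in
     map (\<lambda>x. x - 1) (take d p) @ (if j = 0 then drop d p else remove1 j (drop d p))
       @ replicate (d + j) 1)"

definition Gam_inv :: "nat \<Rightarrow> nat list \<Rightarrow> nat list" where
  "Gam_inv j p = (let d = durfee j p; q = take (length p - (d + j)) p in
     insert_parts (if j = 0 then [] else [j]) (map (\<lambda>x. x + 1) (take d q) @ drop d q))"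

text \<open>In the last case, \<open>r\<close> is at most the first part of \<open>p\<close>, so \<open>part p 1 - r\<close> does not truncate;
  if \<open>part p 2 = 0\<close>, the truncated \<open>part p 2 - 1\<close> does not affect the maximum.\<close>
definition Lam :: "nat list \<Rightarrow> nat list" where
  "Lam p = (let w = num_ones p; e = num_large p; r = max w (part p 2 - 1) in
     if w = 0 then drop 1 p @ replicate (part p 1) 1
     else if e = 0 then w # filter (\<lambda>x. x \<noteq> 1) p
     else map (\<lambda>i. if i = 1 then conj_part p 2 + part p 1 - r
                   else if i \<le> w then 1 + conj_part p i
                   else if i \<le> r then conj_part p (i + 1)
                   else 1) [1..<r + e + 1])"

end

theory Submission
  imports "HOL-Library.Multiset" Defs
begin

text \<open>The number \<open>d\<^sub>m\<close> is characterised by a splitting of the partition into \<open>d\<close> parts that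
  are at least \<open>d + m\<close> and further parts that are at most \<open>d + m\<close>. In terms of this splitting
  \<open>\<phi>\<^sub>j\<close> and \<open>\<psi>\<^sub>j\<close> are mutually inverse, and they preserve the total weight of a pair and
  whether \<open>j\<close> is a part. There are finitely many pairs of a given weight, so an orbit that starts
  outside the image of \<open>\<phi>\<^sub>j\<close> cannot return to itself and has to leave the domain of \<open>\<phi>\<^sub>j\<close>;
  running \<open>\<psi>\<^sub>j\<close> from its end point traces it back. The map \<open>\<Gamma>\<^sub>j\<close> is inverted through the same
  splitting, with the same \<open>d\<close>. Finally, \<open>\<Lambda>\<close> is an involution that negates the crank: generically
  it exchanges \<open>\<omega>\<close> with \<open>\<eta>\<close> and \<open>\<rho>\<close> with the number of parts greater than 1, and both
  facts reduce, part by part, to the equivalence of \<open>u \<le> \<lambda>\<^sup>*\<^sub>i\<close> and \<open>i \<le> \<lambda>\<^sub>u\<close>.\<close>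

section \<open>Sorted lists\<close>

lemma mset_insert_parts [simp]: "mset (insert_parts qs p) = mset qs + mset p"
  by (simp add: insert_parts_def)

lemma set_insert_parts [simp]: "set (insert_parts qs p) = set qs \<union> set p"
  by (simp add: insert_parts_def)

lemma weight_insert_parts [simp]: "weight (insert_parts qs p) = weight qs + weight p"
  by (metis mset_insert_parts sum_mset_sum_list sum_mset.union)

lemma decreasing_insert_parts [simp]: "sorted_wrt (\<ge>) (insert_parts qs p)"
  by (simp add: insert_parts_def sorted_wrt_rev)

text \<open>Reversal turns a decreasing list into a sorted one, and sorting depends only on the
  multiset. Equations between partitions thus become multiset equations.\<close>

lemma decreasing_unique:
  fixes p q :: "nat list"
  assumes "sorted_wrt (\<ge>) p" "sorted_wrt (\<ge>) q" "mset p = mset q"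
  shows "p = q"
proof -
  have "sorted (rev p)" "sorted (rev q)"
    using assms by (simp_all add: sorted_wrt_rev)
  then show ?thesis
    using assms(3) by (metis mset_rev properties_for_sort rev_rev_ident)
qed

lemma insert_parts_eqI:
  "sorted_wrt (\<ge>) r \<Longrightarrow> mset r = mset qs + mset p \<Longrightarrow> insert_parts qs p = r"
  by (rule decreasing_unique) auto

lemma decreasing_remove1:
  fixes p :: "nat list"
  assumes "sorted_wrt (\<ge>) p"
  shows "sorted_wrt (\<ge>) (remove1 x p)"
  using assms by (induction p) (auto dest: notin_set_remove1[THEN contrapos_nn] set_remove1_subset[THEN subsetD])

lemma remove1_insert_parts:
  "sorted_wrt (\<ge>) p \<Longrightarrow> remove1 x (insert_parts [x] p) = p"
  by (rule decreasing_unique) (auto intro: decreasing_remove1)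

lemma insert_parts_remove1:
  "sorted_wrt (\<ge>) p \<Longrightarrow> x \<in> set p \<Longrightarrow> insert_parts [x] (remove1 x p) = p"
  by (rule insert_parts_eqI) auto

lemma insert_parts_empty: "p \<in> partitions \<Longrightarrow> insert_parts [] p = p"
  by (rule insert_parts_eqI) (auto simp: partitions_def)

lemma weight_remove1: "x \<in> set p \<Longrightarrow> weight (remove1 x p) + x = weight p"
  by (induction p) auto

lemma weight_map_Suc: "weight (map Suc p) = weight p + length p"
  by (induction p) auto

lemma weight_map_pred: "0 \<notin> set p \<Longrightarrow> weight (map (\<lambda>x. x - 1) p) + length p = weight p"
  by (induction p) auto

lemma map_Suc_pred: "0 \<notin> set p \<Longrightarrow> map Suc (map (\<lambda>x. x - 1) p) = p"
  by (induction p) auto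

lemma map_pred_Suc: "map (\<lambda>x. x - 1) (map Suc p) = p"
  by (induction p) auto

lemma decreasing_map:
  fixes p :: "nat list"
  shows "sorted_wrt (\<ge>) p \<Longrightarrow> mono f \<Longrightarrow> sorted_wrt (\<ge>) (map f p)"
  by (auto simp: sorted_wrt_map mono_def elim!: sorted_wrt_mono_rel[rotated])

lemma partitions_append:
  "xs @ ys \<in> partitions \<longleftrightarrow>
    xs \<in> partitions \<and> ys \<in> partitions \<and> (\<forall>x\<in>set xs. \<forall>y\<in>set ys. y \<le> x)"
  by (auto simp: partitions_def sorted_wrt_append)

lemma partitions_appendI:
  "xs \<in> partitions \<Longrightarrow> ys \<in> partitions \<Longrightarrow> \<forall>x\<in>set xs. c \<le> x \<Longrightarrow> \<forall>y\<in>set ys. y \<le> c \<Longrightarrow>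
    xs @ ys \<in> partitions"
  by (force simp: partitions_append)

lemma partitions_insert_parts:
  "p \<in> partitions \<Longrightarrow> 0 \<notin> set qs \<Longrightarrow> insert_parts qs p \<in> partitions"
  by (auto simp: partitions_def)

lemma partitions_remove1: "p \<in> partitions \<Longrightarrow> remove1 x p \<in> partitions"
  by (auto simp: partitions_def intro: decreasing_remove1 dest: set_remove1_subset[THEN subsetD])

lemma partitions_map_Suc: "p \<in> partitions \<Longrightarrow> map Suc p \<in> partitions"
  by (auto simp: partitions_def intro: decreasing_map mono_Suc)

lemma partitions_map_pred:
  "p \<in> partitions \<Longrightarrow> \<forall>x\<in>set p. 1 < x \<Longrightarrow> map (\<lambda>x. x - 1) p \<in> partitions"
  by (force simp: partitions_def mono_def intro: decreasing_map)

lemma partitions_Cons: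
  "x # p \<in> partitions \<longleftrightarrow> 0 < x \<and> p \<in> partitions \<and> (\<forall>y\<in>set p. y \<le> x)"
  by (auto simp: partitions_def)

lemma part_Suc: "i < length p \<Longrightarrow> part p (Suc i) = p ! i"
  by (simp add: part_def)

lemma part_append:
  assumes "1 \<le> i" "i \<le> length (xs @ ys)"
  shows "part (xs @ ys) i \<in> (if i \<le> length xs then set xs else set ys)"
  using assms by (auto simp: part_def nth_append)

lemma part_antimono:
  assumes "p \<in> partitions" "1 \<le> u" "u \<le> v"
  shows "part p v \<le> part p u"
  using assms sorted_wrt_nth_less[of "(\<ge>)" p "u - 1" "v - 1"]
  by (cases "u = v") (auto simp: part_def partitions_def)

section \<open>The index \<open>d\<^sub>m\<close>\<close>

text \<open>With \<open>n = length xs\<close>, the difference between the part at \<open>i\<close>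
  and \<open>i\<close> is at least \<open>m\<close> for \<open>i \<le> n\<close> and less than
  \<open>m\<close> afterwards, so the maximum is \<open>n\<close>. Only \<open>i = n\<close> can
  give equality.\<close>

lemma durfee_append:
  assumes p: "xs @ ys \<in> partitions"
    and xs: "\<forall>x\<in>set xs. length xs + m \<le> x" and ys: "\<forall>y\<in>set ys. y \<le> length xs + m"
  shows "durfee m (xs @ ys) = length xs"
    and "xs @ ys \<in> fixfree m \<longleftrightarrow> length xs + m \<notin> set xs"
proof -
  let ?p = "xs @ ys" and ?n = "length xs"
  have large: "?n + m \<le> part ?p i" if "1 \<le> i" "i \<le> ?n" for i
    using part_append[of i xs ys] that xs by auto
  have small: "part ?p i \<le> ?n + m" if "?n < i" "i \<le> length ?p" for i
    using part_append[of i xs ys] that ys by auto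
  show "durfee m ?p = ?n"
    unfolding durfee_def
  proof (rule Max_eqI)
    show "finite {i. i \<le> length ?p \<and> (i = 0 \<or> int m \<le> int (part ?p i) - int i)}"
      by (rule finite_subset[of _ "{..length ?p}"]) auto
    show "y \<le> ?n" if "y \<in> {i. i \<le> length ?p \<and> (i = 0 \<or> int m \<le> int (part ?p i) - int i)}" for y
      using that small[of y] by (cases "y \<le> ?n") auto
    show "?n \<in> {i. i \<le> length ?p \<and> (i = 0 \<or> int m \<le> int (part ?p i) - int i)}"
      using large[of ?n] by (cases "?n = 0") auto
  qed
  have "(\<exists>i. int m = int (part ?p i) - int i \<and> 1 \<le> i \<and> i \<le> length ?p) \<longleftrightarrow> ?n + m \<in> set xs"
  proof
    assume "\<exists>i. int m = int (part ?p i) - int i \<and> 1 \<le> i \<and> i \<le> length ?p"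
    then obtain i where "int m = int (part ?p i) - int i" "1 \<le> i" "i \<le> length ?p"
      by blast
    then have i: "part ?p i = i + m" "1 \<le> i" "i \<le> length ?p"
      by linarith+
    show "?n + m \<in> set xs"
    proof (cases "i \<le> ?n")
      case True
      then have "i = ?n"
        using large[of i] i by auto
      then show ?thesis
        using part_append[of i xs ys] i by auto
    qed (use small[of i] i in auto)
  next
    assume "?n + m \<in> set xs"
    then obtain i where i: "i < ?n" "xs ! i = ?n + m"
      by (auto simp: in_set_conv_nth)
    then have "part ?p ?n \<le> ?n + m"
      using part_antimono[OF p, of "Suc i" ?n] by (auto simp: part_Suc nth_append)
    then have "part ?p ?n = ?n + m" "1 \<le> ?n"
      using large[of ?n] i by auto
    then show "\<exists>i. int m = int (part ?p i) - int i \<and> 1 \<le> i \<and> i \<le> length ?p"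
      by (intro exI[of _ ?n]) auto
  qed
  then show "?p \<in> fixfree m \<longleftrightarrow> ?n + m \<notin> set xs"
    using p by (auto simp: fixfree_def)
qed

text \<open>Maximality of \<open>d\<close> excludes the index \<open>d + 1\<close>, which gives
  \<open>part p (Suc d) \<le> d + m\<close>; monotonicity then bounds both blocks.\<close>

lemma durfee_split:
  assumes p: "p \<in> partitions"
  obtains xs ys where "p = xs @ ys" "durfee m p = length xs"
    "\<forall>x\<in>set xs. length xs + m \<le> x" "\<forall>y\<in>set ys. y \<le> length xs + m"
proof -
  let ?S = "{i. i \<le> length p \<and> (i = 0 \<or> int m \<le> int (part p i) - int i)}"
  define d where "d = durfee m p"
  have fin: "finite ?S"
    by (rule finite_subset[of _ "{..length p}"]) auto
  have "d \<in> ?S"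
    unfolding d_def durfee_def by (rule Max_in[OF fin]) auto
  then have d: "d \<le> length p" "d = 0 \<or> d + m \<le> part p d"
    by auto
  have large: "d + m \<le> part p i" if "1 \<le> i" "i \<le> d" for i
    using part_antimono[OF p that] d that by auto
  have "Suc d \<notin> ?S"
    using Max_ge[OF fin, of "Suc d"] unfolding durfee_def[symmetric] d_def[symmetric] by linarith
  then have "part p (Suc d) \<le> d + m"
    by (cases "Suc d \<le> length p") (auto simp: part_def)
  then have small: "part p i \<le> d + m" if "d < i" for i
    using part_antimono[OF p, of "Suc d" i] that by auto
  show thesis
  proof
    show "p = take d p @ drop d p" by simp
    show "durfee m p = length (take d p)" using d by (simp add: d_def)
    show "\<forall>x\<in>set (take d p). length (take d p) + m \<le> x"
    proof
      fix x assume "x \<in> set (take d p)"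
      then obtain i where "i < d" "x = p ! i"
        by (auto simp: in_set_conv_nth)
      then show "length (take d p) + m \<le> x"
        using large[of "Suc i"] d by (simp add: part_Suc)
    qed
    show "\<forall>y\<in>set (drop d p). y \<le> length (take d p) + m"
    proof
      fix y assume "y \<in> set (drop d p)"
      then obtain i where "i < length p - d" "y = p ! (d + i)"
        by (auto simp: in_set_conv_nth)
      then show "y \<le> length (take d p) + m"
        using small[of "Suc (d + i)"] d by (simp add: part_Suc)
    qed
  qed
qed

lemma fixfree_split:
  assumes "p \<in> fixfree m"
  obtains xs ys where "p = xs @ ys" "durfee m p = length xs"
    "\<forall>x\<in>set xs. length xs + m < x" "\<forall>y\<in>set ys. y \<le> length xs + m"
proof -
  have p: "p \<in> partitions" using assms by (simp add: fixfree_def)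
  obtain xs ys where s: "p = xs @ ys" "durfee m p = length xs"
    "\<forall>x\<in>set xs. length xs + m \<le> x" "\<forall>y\<in>set ys. y \<le> length xs + m"
    using durfee_split[OF p] .
  then have "length xs + m \<notin> set xs"
    using durfee_append(2)[of xs ys m] p assms by auto
  with s that show thesis
    by (metis le_neq_implies_less)
qed

text \<open>The fixed part is the last of the first \<open>d\<close> parts. It is split off, so that
  \<open>xs\<close> consists of the \<open>d - 1\<close> parts that \<open>phi\<close> and
  \<open>psi\<close> raise.\<close>

lemma not_fixfree_split:
  assumes "p \<in> partitions" "p \<notin> fixfree m"
  obtains xs ys where "p = xs @ (Suc (length xs) + m) # ys" "durfee m p = Suc (length xs)"
proof -
  obtain xs ys where s: "p = xs @ ys" "durfee m p = length xs"
    "\<forall>x\<in>set xs. length xs + m \<le> x" "\<forall>y\<in>set ys. y \<le> length xs + m"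
    using durfee_split[OF assms(1)] .
  then have *: "length xs + m \<in> set xs"
    using durfee_append(2)[of xs ys m] assms unfolding s(1) by blast
  then have "xs \<noteq> []"
    by auto
  then obtain zs z where z: "xs = zs @ [z]"
    by (metis rev_exhaust)
  have "z \<le> length xs + m"
    using * assms(1) unfolding s(1) partitions_append z by auto
  moreover have "length xs + m \<le> z"
    using s(3) unfolding z by simp
  ultimately have "z = Suc (length zs) + m"
    by (simp add: z)
  then have "p = zs @ (Suc (length zs) + m) # ys"
    using s(1) unfolding z by simp
  moreover have "durfee m p = Suc (length zs)"
    using s(2) unfolding z by simp
  ultimately show thesis
    by (rule that)
qed

lemma durfee_fixed_part:
  assumes p: "xs @ (Suc (length xs) + m) # ys \<in> partitions"
  shows "durfee m (xs @ (Suc (length xs) + m) # ys) = Suc (length xs)"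
    and "xs @ (Suc (length xs) + m) # ys \<notin> fixfree m"
  using durfee_append[of "xs @ [Suc (length xs) + m]" ys m] p
  by (auto simp: partitions_append partitions_Cons)

lemma durfee_fixfree:
  assumes p: "xs @ ys \<in> partitions"
    and "\<forall>x\<in>set xs. length xs + m < x" "\<forall>y\<in>set ys. y \<le> length xs + m"
  shows "durfee m (xs @ ys) = length xs" and "xs @ ys \<in> fixfree m"
  using durfee_append[of xs ys m] assms by (auto simp: order_less_imp_le)

lemma part_durfee:
  assumes "p \<in> partitions" "p \<notin> fixfree m"
  shows "1 \<le> durfee m p" "part p (durfee m p) = durfee m p + m"
proof -
  obtain xs ys where "p = xs @ (Suc (length xs) + m) # ys" "durfee m p = Suc (length xs)"
    using not_fixfree_split[OF assms] .
  then show "1 \<le> durfee m p" "part p (durfee m p) = durfee m p + m"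
    by (simp_all add: part_Suc)
qed

text \<open>If \<open>d > 0\<close>, the first \<open>d\<close> parts are at least
  \<open>d + m > m\<close>. Hence the copy of \<open>m\<close> that \<open>psi\<close> deletes lies
  after them.\<close>

lemma part_after_durfee:
  assumes "p \<in> partitions" "m \<in> set p"
  shows "m \<in> set (drop (durfee m p) p)"
proof -
  obtain xs ys where s: "p = xs @ ys" "durfee m p = length xs"
    "\<forall>x\<in>set xs. length xs + m \<le> x"
    using durfee_split[OF assms(1)] by metis
  have "m \<notin> set xs"
    using s(3) by (cases xs) auto
  then show ?thesis
    using s(1,2) assms(2) by simp
qed

section \<open>The maps \<open>\<phi>\<^sub>j\<close> and \<open>\<psi>\<^sub>j\<close>\<close>

text \<open>With \<open>d = Suc (length xs)\<close>, the raised parts exceed \<open>d + m\<close>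
  and the others, including \<open>m + 1\<close>, do not. So sorting only affects the tail.\<close>

lemma phi_fixed_part:
  assumes m: "m = j + 2 * k" and p: "xs @ (Suc (length xs) + m) # ys \<in> partitions"
  shows "phi j (k, xs @ (Suc (length xs) + m) # ys) = (k, map Suc xs @ insert_parts [Suc m] ys)"
    and "map Suc xs @ insert_parts [Suc m] ys \<in> partitions"
proof -
  have ps: "xs \<in> partitions" "ys \<in> partitions" "\<forall>x\<in>set xs. Suc (length xs) + m \<le> x"
    "\<forall>y\<in>set ys. y \<le> Suc (length xs) + m"
    using p by (auto simp: partitions_append partitions_Cons)
  show r: "map Suc xs @ insert_parts [Suc m] ys \<in> partitions"
    by (rule partitions_appendI[where c = "Suc (length xs) + m"])
       (use ps in \<open>auto intro: partitions_map_Suc partitions_insert_parts\<close>)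
  have "insert_parts [Suc m] (map Suc xs @ ys) = map Suc xs @ insert_parts [Suc m] ys"
    by (rule insert_parts_eqI) (use r in \<open>auto simp: partitions_def\<close>)
  then show "phi j (k, xs @ (Suc (length xs) + m) # ys) = (k, map Suc xs @ insert_parts [Suc m] ys)"
    using durfee_fixed_part[OF p] by (simp add: phi_def m Let_def)
qed

text \<open>After lowering, the first \<open>d\<close> parts are still at least
  \<open>d + m\<close>, so the new part \<open>d + m\<close> fits directly behind them. From
  \<open>0 < k\<close> follows \<open>m \<ge> 2\<close>, so the inserted \<open>m - 1\<close> is
  positive.\<close>

lemma phi_fixfree:
  assumes m: "m = j + 2 * k" and k: "0 < k" and p: "xs @ ys \<in> partitions"
    and xs: "\<forall>x\<in>set xs. length xs + m < x" and ys: "\<forall>y\<in>set ys. y \<le> length xs + m"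
  shows "phi j (k, xs @ ys) =
      (k - 1, map (\<lambda>x. x - 1) xs @ (length xs + m) # insert_parts [m - 1] ys)"
    and "map (\<lambda>x. x - 1) xs @ (length xs + m) # insert_parts [m - 1] ys \<in> partitions"
proof -
  have ps: "xs \<in> partitions" "ys \<in> partitions"
    using p by (auto simp: partitions_append)
  show r: "map (\<lambda>x. x - 1) xs @ (length xs + m) # insert_parts [m - 1] ys \<in> partitions"
  proof (rule partitions_appendI[where c = "length xs + m"])
    show "map (\<lambda>x. x - 1) xs \<in> partitions"
      using xs ps m k by (intro partitions_map_pred) fastforce+
    show "(length xs + m) # insert_parts [m - 1] ys \<in> partitions"
      using ps ys m k by (auto simp: partitions_Cons intro!: partitions_insert_parts)
    show "\<forall>x\<in>set (map (\<lambda>x. x - 1) xs). length xs + m \<le> x"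
      using xs by fastforce
    show "\<forall>y\<in>set ((length xs + m) # insert_parts [m - 1] ys). y \<le> length xs + m"
      using ys by auto
  qed
  have "insert_parts [length xs + m, m - 1] (map (\<lambda>x. x - 1) xs @ ys) =
      map (\<lambda>x. x - 1) xs @ (length xs + m) # insert_parts [m - 1] ys"
    by (rule insert_parts_eqI) (use r in \<open>auto simp: partitions_def\<close>)
  then show "phi j (k, xs @ ys) =
      (k - 1, map (\<lambda>x. x - 1) xs @ (length xs + m) # insert_parts [m - 1] ys)"
    using durfee_fixfree[OF p xs ys] by (simp add: phi_def m Let_def)
qed

lemma psi_fixed_part:
  assumes m: "m = j + 2 * k + 1" and p: "xs @ (Suc (length xs) + m) # ys \<in> partitions"
  shows "psi j (k, xs @ (Suc (length xs) + m) # ys) = (k + 1, map Suc xs @ remove1 m ys)"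
    and "map Suc xs @ remove1 m ys \<in> partitions"
proof -
  have ps: "xs \<in> partitions" "ys \<in> partitions" "\<forall>x\<in>set xs. Suc (length xs) + m \<le> x"
    "\<forall>y\<in>set ys. y \<le> Suc (length xs) + m"
    using p by (auto simp: partitions_append partitions_Cons)
  show "map Suc xs @ remove1 m ys \<in> partitions"
    by (rule partitions_appendI[where c = "Suc (length xs) + m"])
       (use ps in \<open>auto intro: partitions_map_Suc partitions_remove1 dest: set_remove1_subset[THEN subsetD]\<close>)
  show "psi j (k, xs @ (Suc (length xs) + m) # ys) = (k + 1, map Suc xs @ remove1 m ys)"
    using durfee_fixed_part[OF p] by (simp add: psi_def m Let_def)
qed

lemma psi_fixfree:
  assumes m: "m = j + 2 * k + 1" and p: "xs @ ys \<in> partitions"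
    and xs: "\<forall>x\<in>set xs. length xs + m < x" and ys: "\<forall>y\<in>set ys. y \<le> length xs + m"
  shows "psi j (k, xs @ ys) = (k, map (\<lambda>x. x - 1) xs @ (length xs + m) # remove1 m ys)"
    and "map (\<lambda>x. x - 1) xs @ (length xs + m) # remove1 m ys \<in> partitions"
proof -
  have ps: "xs \<in> partitions" "ys \<in> partitions"
    using p by (auto simp: partitions_append)
  show r: "map (\<lambda>x. x - 1) xs @ (length xs + m) # remove1 m ys \<in> partitions"
  proof (rule partitions_appendI[where c = "length xs + m"])
    show "map (\<lambda>x. x - 1) xs \<in> partitions"
      using xs ps m by (intro partitions_map_pred) fastforce+
    show "(length xs + m) # remove1 m ys \<in> partitions"
      using ps ys m
      by (auto simp: partitions_Cons intro!: partitions_remove1 dest: set_remove1_subset[THEN subsetD])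
    show "\<forall>x\<in>set (map (\<lambda>x. x - 1) xs). length xs + m \<le> x"
      using xs by fastforce
    show "\<forall>y\<in>set ((length xs + m) # remove1 m ys). y \<le> length xs + m"
      using ys by (auto dest: set_remove1_subset[THEN subsetD])
  qed
  have "insert_parts [length xs + m] (map (\<lambda>x. x - 1) xs @ remove1 m ys) =
      map (\<lambda>x. x - 1) xs @ (length xs + m) # remove1 m ys"
    by (rule insert_parts_eqI) (use r in \<open>auto simp: partitions_def\<close>)
  then show "psi j (k, xs @ ys) = (k, map (\<lambda>x. x - 1) xs @ (length xs + m) # remove1 m ys)"
    using durfee_fixfree[OF p xs ys] by (simp add: psi_def m Let_def)
qed

section \<open>The staircases \<open>Delta j k\<close>, and \<open>phi\<close> and
  \<open>psi\<close> as mutual inverses\<close>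

lemma Delta_0 [simp]: "Delta j 0 = []"
  by (simp add: Delta_def)

lemma Delta_Suc: "Delta j (Suc k) = (j + k + 1) # Delta j k"
  by (simp add: Delta_def)

lemma set_Delta: "set (Delta j k) = {j<..j + k}"
  by (auto simp: Delta_def)

lemma distinct_Delta: "distinct (Delta j k)"
  by (simp add: Delta_def)

lemma weight_Delta_ge: "k \<le> weight (Delta j k)"
  by (induction k) (auto simp: Delta_Suc)

text \<open>Each case of \<open>phi\<close> leads into the opposite case of \<open>psi\<close>.
  Raising \<open>d - 1\<close> parts past \<open>d + m = (d - 1) + (m + 1)\<close> puts the image
  into \<open>fixfree (m + 1)\<close>; in the other case the new part
  \<open>d + m = (d + 1) + (m - 1)\<close> at position \<open>d + 1\<close> is a fixed part for
  \<open>m - 1\<close>.\<close>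

lemma phi_inverse:
  assumes q: "q \<in> partitions" and dom: "\<not> (k = 0 \<and> q \<in> fixfree j)"
  obtains k' q' where "phi j (k, q) = (k', q')" "q' \<in> with_part (j + 2 * k' + 1)"
    "psi j (k', q') = (k, q)" "weight (from_pair j (k', q')) = weight (from_pair j (k, q))"
    "j \<in> set q' \<longleftrightarrow> j \<in> set q"
proof (cases "q \<in> fixfree (j + 2 * k)")
  case False
  define m where "m = j + 2 * k"
  obtain xs ys where s: "q = xs @ (Suc (length xs) + m) # ys"
    using not_fixfree_split[OF q False] by (metis m_def)
  let ?r = "map Suc xs @ insert_parts [Suc m] ys"
  have p: "xs @ (Suc (length xs) + m) # ys \<in> partitions"
    using q s by simp
  note f = phi_fixed_part[OF m_def p]
  have xs: "\<forall>x\<in>set xs. Suc (length xs) + m \<le> x" and ys: "\<forall>y\<in>set ys. y \<le> Suc (length xs) + m"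
    "sorted_wrt (\<ge>) ys"
    using p by (auto simp: partitions_append partitions_Cons) (simp add: partitions_def)
  have "psi j (k, ?r) = (k, map (\<lambda>x. x - 1) (map Suc xs) @ (length (map Suc xs) + Suc m) #
      remove1 (Suc m) (insert_parts [Suc m] ys))"
    by (rule psi_fixfree(1)) (use xs ys f in \<open>auto simp: m_def\<close>)
  then have psi: "psi j (k, ?r) = (k, q)"
    using ys by (simp add: remove1_insert_parts map_pred_Suc[simplified] s)
  show thesis
  proof (rule that)
    show "phi j (k, q) = (k, ?r)" using f(1) by (simp add: s)
    show "?r \<in> with_part (j + 2 * k + 1)" using f(2) by (simp add: with_part_def m_def)
    show "weight (from_pair j (k, ?r)) = weight (from_pair j (k, q))"
      by (simp add: s weight_map_Suc)
    show "j \<in> set ?r \<longleftrightarrow> j \<in> set q" using xs by (auto simp: s m_def)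
  qed (fact psi)
next
  case True
  define m where "m = j + 2 * k"
  obtain l where k: "k = Suc l"
    using True dom by (cases k) auto
  obtain xs ys where s: "q = xs @ ys" and xs: "\<forall>x\<in>set xs. length xs + m < x"
    and ys: "\<forall>y\<in>set ys. y \<le> length xs + m"
    using fixfree_split[OF True] by (metis m_def)
  let ?r = "map (\<lambda>x. x - 1) xs @ (length xs + m) # insert_parts [m - 1] ys"
  have p: "xs @ ys \<in> partitions"
    using q s by simp
  have "0 < k" by (simp add: k)
  note f = phi_fixfree[OF m_def this p xs ys]
  have pos: "0 \<notin> set xs" and dec: "sorted_wrt (\<ge>) ys"
    using p by (auto simp: partitions_def sorted_wrt_append)
  have r: "?r = map (\<lambda>x. x - 1) xs @ (Suc (length (map (\<lambda>x. x - 1) xs)) + (m - 1)) #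
      insert_parts [m - 1] ys"
    by (simp add: m_def k)
  have "psi j (l, ?r) =
      (l + 1, map Suc (map (\<lambda>x. x - 1) xs) @ remove1 (m - 1) (insert_parts [m - 1] ys))"
    unfolding r by (rule psi_fixed_part(1)) (use f(2) r in \<open>simp_all add: m_def k\<close>)
  then have psi: "psi j (l, ?r) = (k, q)"
    using map_Suc_pred[OF pos] dec by (simp add: remove1_insert_parts s k)
  show thesis
  proof (rule that)
    show "phi j (k, q) = (l, ?r)" using f(1) by (simp add: s k)
    show "?r \<in> with_part (j + 2 * l + 1)" using f(2) by (simp add: with_part_def m_def k)
    \<comment> \<open>Lowering loses \<open>d\<close>, inserting gains \<open>d + m\<close> and
      \<open>m - 1\<close>; the net gain is the weight of the entries \<open>m\<close> and
      \<open>m - 1\<close> dropped from the staircase.\<close>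
    show "weight (from_pair j (l, ?r)) = weight (from_pair j (k, q))"
      using weight_map_pred[OF pos] by (simp add: s k m_def Delta_Suc)
    show "j \<in> set ?r \<longleftrightarrow> j \<in> set q" using xs by (fastforce simp: s m_def k)
  qed (fact psi)
qed

lemma psi_inverse:
  assumes q: "q \<in> with_part (j + 2 * k + 1)"
  obtains k' q' where "psi j (k, q) = (k', q')" "q' \<in> partitions"
    "\<not> (k' = 0 \<and> q' \<in> fixfree j)"
    "phi j (k', q') = (k, q)" "weight (from_pair j (k', q')) = weight (from_pair j (k, q))"
    "j \<in> set q' \<longleftrightarrow> j \<in> set q"
proof -
  define m where "m = j + 2 * k + 1"
  have q: "q \<in> partitions" and mq: "m \<in> set q"
    using q by (auto simp: with_part_def m_def)
  have "\<exists>k' q'. psi j (k, q) = (k', q') \<and> q' \<in> partitions \<and> \<not> (k' = 0 \<and> q' \<in> fixfree j) \<and>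
    phi j (k', q') = (k, q)"
  proof (cases "q \<in> fixfree m")
    case False
    obtain xs ys where s: "q = xs @ (Suc (length xs) + m) # ys"
      using not_fixfree_split[OF q False] by metis
    let ?r = "map Suc xs @ remove1 m ys"
    have p: "xs @ (Suc (length xs) + m) # ys \<in> partitions"
      using q s by simp
    note f = psi_fixed_part[OF m_def p]
    have xs: "\<forall>x\<in>set xs. Suc (length xs) + m \<le> x"
      and ys: "\<forall>y\<in>set ys. y \<le> Suc (length xs) + m" "sorted_wrt (\<ge>) ys"
      using p by (auto simp: partitions_append partitions_Cons) (simp add: partitions_def)
    have m: "m \<in> set ys" using mq xs by (auto simp: s)
    have "phi j (Suc k, ?r) = (Suc k - 1, map (\<lambda>x. x - 1) (map Suc xs) @ (length (map Suc xs) + Suc m) #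
        insert_parts [Suc m - 1] (remove1 m ys))"
      by (rule phi_fixfree(1))
        (use xs ys f in \<open>auto simp: m_def dest: set_remove1_subset[THEN subsetD]\<close>)
    then have "phi j (Suc k, ?r) = (k, q)"
      using m ys by (simp add: insert_parts_remove1 map_pred_Suc[simplified] s)
    then show ?thesis using f by (intro exI[of _ "Suc k"] exI[of _ ?r]) (simp add: s)
  next
    case True
    obtain xs ys where s: "q = xs @ ys" and xs: "\<forall>x\<in>set xs. length xs + m < x"
      and ys: "\<forall>y\<in>set ys. y \<le> length xs + m"
      using fixfree_split[OF True] by metis
    let ?r = "map (\<lambda>x. x - 1) xs @ (length xs + m) # remove1 m ys"
    have p: "xs @ ys \<in> partitions"
      using q s by simp
    note f = psi_fixfree[OF m_def p xs ys]
    have pos: "0 \<notin> set xs" and dec: "sorted_wrt (\<ge>) ys"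
      using p by (auto simp: partitions_def sorted_wrt_append)
    have m: "m \<in> set ys" using mq xs by (auto simp: s)
    have r: "?r = map (\<lambda>x. x - 1) xs @ (Suc (length (map (\<lambda>x. x - 1) xs)) + (m - 1)) # remove1 m ys"
      by (simp add: m_def)
    have "phi j (k, ?r) =
        (k, map Suc (map (\<lambda>x. x - 1) xs) @ insert_parts [Suc (m - 1)] (remove1 m ys))"
      unfolding r by (rule phi_fixed_part(1)) (use f(2) r in \<open>simp_all add: m_def\<close>)
    then have phi: "phi j (k, ?r) = (k, q)"
      using map_Suc_pred[OF pos] dec m by (simp add: insert_parts_remove1 s m_def)
    have "?r \<notin> fixfree (j + 2 * k)"
      unfolding r using durfee_fixed_part(2)[of "map (\<lambda>x. x - 1) xs" "m - 1" "remove1 m ys"] f(2) r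
      by (simp add: m_def)
    then show ?thesis using f phi by (intro exI[of _ k] exI[of _ ?r]) (auto simp: s)
  qed
  then obtain k' q' where *: "psi j (k, q) = (k', q')" "q' \<in> partitions"
    "\<not> (k' = 0 \<and> q' \<in> fixfree j)" "phi j (k', q') = (k, q)"
    by blast
  \<comment> \<open>Both invariants come from \<open>phi_inverse\<close> at \<open>(k', q')\<close>,
    because \<open>phi\<close> maps that pair back to \<open>(k, q)\<close>.\<close>
  then show thesis
    using phi_inverse[OF *(2,3)] that by (metis prod.inject)
qed

text \<open>An abstract orbit argument that serves both directions. The guard \<open>bg\<close> of
  the reverse loop holds at every image under \<open>f\<close> but not at the start, so the reverse
  loop stops exactly at \<open>s\<close>.\<close>

lemma while_option_reverse:
  assumes fin: "finite X" and s: "s \<in> X" "\<not> bg s"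
    and step: "\<And>x. x \<in> X \<Longrightarrow> bf x \<Longrightarrow> f x \<in> X \<and> bg (f x) \<and> g (f x) = x"
  obtains t where "t \<in> X" "\<not> bf t" "while_option bf f s = Some t" "while_option bg g t = Some s"
proof -
  have "\<exists>n. \<not> bf ((f ^^ n) s)"
  proof (rule ccontr)
    assume "\<not> ?thesis"
    then have run: "bf ((f ^^ n) s)" for n by blast
    have X: "(f ^^ n) s \<in> X" for n
      by (induction n) (use s step run in auto)
    have rewind: "(g ^^ i) ((f ^^ (i + n)) s) = (f ^^ n) s" for i n
    proof (induction i)
      case (Suc i)
      then show ?case
        using step[OF X run, of "i + n"] by (simp add: funpow_swap1)
    qed simp
    \<comment> \<open>A repetition in the orbit could be rewound to one at \<open>s\<close>, making
      \<open>s\<close> an image of \<open>f\<close> against \<open>\<not> bg s\<close>.\<close>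
    have "(f ^^ i) s \<noteq> (f ^^ (i + Suc n)) s" for i n
    proof
      assume "(f ^^ i) s = (f ^^ (i + Suc n)) s"
      then have "s = (f ^^ Suc n) s"
        using rewind[of i 0] rewind[of i "Suc n"] by simp
      then show False
        using step[OF X run, of n] s(2) by simp
    qed
    then have "(f ^^ i) s \<noteq> (f ^^ k) s" if "i < k" for i k
      using less_imp_Suc_add[OF that] by auto
    then have "inj (\<lambda>n. (f ^^ n) s)"
      by (intro injI) (metis linorder_neqE_nat)
    then have "infinite (range (\<lambda>n. (f ^^ n) s))"
      by (simp add: finite_image_iff)
    then show False
      using X fin by (metis finite_subset image_subsetI)
  qed
  then obtain t where t: "while_option bf f s = Some t"
    by (auto simp: while_option_def)
  \<comment> \<open>The loop invariant is that running \<open>g\<close> from the current state ends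
    in \<open>s\<close>; each step of \<open>f\<close> prepends one step of
    \<open>g\<close>.\<close>
  have "t \<in> X \<and> while_option bg g t = Some s"
  proof (rule while_option_rule[OF _ t])
    fix x assume x: "x \<in> X \<and> while_option bg g x = Some s" "bf x"
    then show "f x \<in> X \<and> while_option bg g (f x) = Some s"
      using step[of x] by (subst while_option_unfold) auto
  next
    show "s \<in> X \<and> while_option bg g s = Some s"
      using s by (subst while_option_unfold) auto
  qed
  then show thesis
    using that t while_option_stop[OF t] by blast
qed

section \<open>The maps \<open>\<Phi>\<^sub>j\<close> and \<open>\<Psi>\<^sub>j\<close>\<close>

lemma finite_partitions_le: "finite {p \<in> partitions. weight p \<le> n}"
proof (rule finite_subset)
  show "finite {p. set p \<subseteq> {..n} \<and> length p \<le> n}"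
    by (rule finite_lists_length_le) simp
  have "length p \<le> weight p" if "0 \<notin> set p" for p :: "nat list"
    using that by (induction p) auto
  then show "{p \<in> partitions. weight p \<le> n} \<subseteq> {p. set p \<subseteq> {..n} \<and> length p \<le> n}"
    by (force simp: partitions_def dest: member_le_sum_list)
qed

text \<open>The invariant set of both iterations. The flag \<open>b\<close> carries the condition
  that \<open>j\<close> is a part across \<open>Phi\<close> and \<open>Psi\<close>.\<close>

definition pairs :: "nat \<Rightarrow> nat \<Rightarrow> bool \<Rightarrow> (nat \<times> nat list) set" where
  "pairs j n b = {(k, q). q \<in> partitions \<and> weight (from_pair j (k, q)) = n \<and> (j \<in> set q \<longleftrightarrow> b)}"

lemma finite_pairs: "finite (pairs j n b)"
proof (rule finite_subset)
  show "pairs j n b \<subseteq> {..n} \<times> {p \<in> partitions. weight p \<le> n}"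
  proof (clarsimp simp: pairs_def)
    show "k \<le> weight (Delta j (2 * k)) + weight q" for k q
      using weight_Delta_ge[of "2 * k" j] by simp
  qed
qed (simp add: finite_partitions_le)

section \<open>The identification of \<open>odd_mex j\<close> with pairs\<close>

lemma mex_from_pair:
  assumes q: "q \<in> partitions - with_part (j + 2 * k + 1)"
  shows "mex j (from_pair j (k, q)) = j + 2 * k + 1"
  unfolding mex_def
proof (rule Least_equality)
  show "j < j + 2 * k + 1 \<and> j + 2 * k + 1 \<notin> set (from_pair j (k, q))"
    using q by (auto simp: with_part_def set_Delta)
  show "j + 2 * k + 1 \<le> m" if "j < m \<and> m \<notin> set (from_pair j (k, q))" for m
    using that by (auto simp: set_Delta)
qed

lemma from_pair_odd_mex:
  assumes q: "q \<in> partitions - with_part (j + 2 * k + 1)"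
  shows "from_pair j (k, q) \<in> odd_mex j"
  using q mex_from_pair[OF q]
  by (auto simp: odd_mex_def set_Delta intro!: partitions_insert_parts)

lemma mset_fold_remove1: "mset (fold remove1 xs p) = mset p - mset xs"
  by (induction xs arbitrary: p) auto

lemma partitions_fold_remove1: "p \<in> partitions \<Longrightarrow> fold remove1 xs p \<in> partitions"
  by (induction xs arbitrary: p) (auto intro: partitions_remove1)

lemma partitions_unique: "p \<in> partitions \<Longrightarrow> q \<in> partitions \<Longrightarrow> mset p = mset q \<Longrightarrow> p = q"
  by (auto simp: partitions_def intro: decreasing_unique)

lemma to_pair_from_pair:
  assumes q: "q \<in> partitions - with_part (j + 2 * k + 1)"
  shows "to_pair j (from_pair j (k, q)) = (k, q)"
proof -
  have "fold remove1 (Delta j (2 * k)) (from_pair j (k, q)) = q"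
    by (rule partitions_unique)
      (use q from_pair_odd_mex[OF q] in
        \<open>auto simp: mset_fold_remove1 odd_mex_def intro: partitions_fold_remove1\<close>)
  then show ?thesis
    using mex_from_pair[OF q] by (simp add: to_pair_def Let_def)
qed

lemma from_pair_to_pair:
  assumes p: "p \<in> odd_mex j"
  shows "to_pair j p \<in> {(k, q). q \<in> partitions - with_part (j + 2 * k + 1)}"
    and "from_pair j (to_pair j p) = p"
proof -
  \<comment> \<open>No part exceeds the weight, so the \<open>LEAST\<close> in \<open>mex\<close> is
    attained.\<close>
  have ex: "\<exists>m. j < m \<and> m \<notin> set p"
  proof (intro exI conjI notI)
    show "j < j + weight p + 1" by simp
    show False if "j + weight p + 1 \<in> set p"
      using member_le_sum_list[OF that] by simp
  qed
  have mex: "j < mex j p" "mex j p \<notin> set p"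
    using LeastI_ex[OF ex] by (auto simp: mex_def)
  have below: "i \<in> set p" if "j < i" "i < mex j p" for i
    using not_less_Least[of i] that unfolding mex_def by blast
  have "odd (mex j p - j)"
    using p by (simp add: odd_mex_def)
  then obtain k where "mex j p - j = 2 * k + 1"
    by (elim oddE)
  then have k: "mex j p = j + 2 * k + 1" using mex by simp
  define q where "q = fold remove1 (Delta j (2 * k)) p"
  have to: "to_pair j p = (k, q)"
    by (simp add: to_pair_def k q_def)
  have pp: "p \<in> partitions" using p by (simp add: odd_mex_def)
  then have q: "q \<in> partitions"
    by (simp add: q_def partitions_fold_remove1)
  have mq: "mset q = mset p - mset (Delta j (2 * k))"
    by (simp add: q_def mset_fold_remove1)
  have "set q \<subseteq> set p"
    by (metis diff_subset_eq_self mq set_mset_mono set_mset_mset)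
  then have "q \<notin> with_part (j + 2 * k + 1)"
    using mex k by (auto simp: with_part_def)
  then show "to_pair j p \<in> {(k, q). q \<in> partitions - with_part (j + 2 * k + 1)}"
    using q to by simp
  have "set (Delta j (2 * k)) \<subseteq> set p"
    using below k by (auto simp: set_Delta)
  \<comment> \<open>The staircase has no repeated entries, so set inclusion gives multiset
    inclusion.\<close>
  then have "mset (Delta j (2 * k)) \<subseteq># mset p"
    using distinct_Delta[of j "2 * k"]
    by (intro mset_subset_eqI) (auto simp: distinct_count_atmost_1 Suc_le_eq)
  then show "from_pair j (to_pair j p) = p"
    using pp by (simp add: to mq insert_parts_eqI partitions_def)
qed

lemma fixfree_pairs: "p \<in> fixfree j \<Longrightarrow> (0, p) \<in> pairs j (weight p) (j \<in> set p)"
  by (simp add: pairs_def fixfree_def)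

lemma odd_mex_pairs:
  assumes "p \<in> odd_mex j"
  shows "to_pair j p \<in> pairs j (weight p) (j \<in> set p)"
proof -
  obtain k q where kq: "to_pair j p = (k, q)" by (cases "to_pair j p")
  then have "p = insert_parts (Delta j (2 * k)) q"
    using from_pair_to_pair(2)[OF assms] by simp
  then show ?thesis
    using from_pair_to_pair(1)[OF assms] kq by (auto simp: pairs_def set_Delta)
qed

text \<open>The start pair lacks the part \<open>j + 2 * k + 1\<close>, so it lies outside the
  domain of \<open>psi\<close>; \<open>while_option_reverse\<close> then yields termination together
  with the return run.\<close>

lemma Phi_props:
  assumes p: "p \<in> odd_mex j"
  shows "Phi_run j p \<noteq> None" "Phi j p \<in> fixfree j" "weight (Phi j p) = weight p"
    "j \<in> set (Phi j p) \<longleftrightarrow> j \<in> set p" "Psi j (Phi j p) = p"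
proof -
  have "\<exists>t. t \<in> pairs j (weight p) (j \<in> set p) \<and> \<not> (\<lambda>(k, q). \<not> (k = 0 \<and> q \<in> fixfree j)) t \<and>
    Phi_run j p = Some t \<and>
    while_option (\<lambda>(k, q). q \<in> with_part (j + 2 * k + 1)) (psi j) t = Some (to_pair j p)"
    unfolding Phi_run_def
  proof (rule while_option_reverse[OF finite_pairs odd_mex_pairs[OF p]])
    show "\<not> (\<lambda>(k, q). q \<in> with_part (j + 2 * k + 1)) (to_pair j p)"
      using from_pair_to_pair(1)[OF p] by auto
  next
    fix x assume x: "x \<in> pairs j (weight p) (j \<in> set p)" "(\<lambda>(k, q). \<not> (k = 0 \<and> q \<in> fixfree j)) x"
    obtain k q where kq: "x = (k, q)" by (cases x)
    have "q \<in> partitions" "\<not> (k = 0 \<and> q \<in> fixfree j)"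
      using x by (simp_all add: kq pairs_def)
    then obtain k' q' where "phi j (k, q) = (k', q')" "q' \<in> with_part (j + 2 * k' + 1)"
      "psi j (k', q') = (k, q)" "weight (from_pair j (k', q')) = weight (from_pair j (k, q))"
      "j \<in> set q' \<longleftrightarrow> j \<in> set q"
      using phi_inverse by blast
    then show "phi j x \<in> pairs j (weight p) (j \<in> set p) \<and>
        (\<lambda>(k, q). q \<in> with_part (j + 2 * k + 1)) (phi j x) \<and> psi j (phi j x) = x"
      using x by (simp add: kq pairs_def with_part_def)
  qed blast
  \<comment> \<open>Leaving the loop means \<open>k = 0\<close>, so the return run starts at
    \<open>(0, q)\<close> and is \<open>Psi_run j q\<close>.\<close>
  then obtain q where t: "(0, q) \<in> pairs j (weight p) (j \<in> set p)" "q \<in> fixfree j"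
    "Phi_run j p = Some (0, q)" "Psi_run j q = Some (to_pair j p)"
    by (auto simp: Psi_run_def)
  then have Phi: "Phi j p = q" by (simp add: Phi_def)
  show "Phi_run j p \<noteq> None" "Phi j p \<in> fixfree j" "weight (Phi j p) = weight p"
    "j \<in> set (Phi j p) \<longleftrightarrow> j \<in> set p" "Psi j (Phi j p) = p"
    using t from_pair_to_pair(2)[OF p] by (auto simp: Phi Psi_def pairs_def)
qed

text \<open>The same argument with \<open>phi\<close> and \<open>psi\<close> exchanged: the start
  \<open>(0, p)\<close> lies outside the domain of \<open>phi\<close>, and \<open>to_pair\<close>
  recovers the final pair as the start of \<open>Phi_run\<close>.\<close>

lemma Psi_props:
  assumes p: "p \<in> fixfree j"
  shows "Psi_run j p \<noteq> None" "Psi j p \<in> odd_mex j" "weight (Psi j p) = weight p"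
    "j \<in> set (Psi j p) \<longleftrightarrow> j \<in> set p" "Phi j (Psi j p) = p"
proof -
  have "\<exists>t. t \<in> pairs j (weight p) (j \<in> set p) \<and> \<not> (\<lambda>(k, q). q \<in> with_part (j + 2 * k + 1)) t \<and>
    Psi_run j p = Some t \<and>
    while_option (\<lambda>(k, q). \<not> (k = 0 \<and> q \<in> fixfree j)) (phi j) t = Some (0, p)"
    unfolding Psi_run_def
  proof (rule while_option_reverse[OF finite_pairs fixfree_pairs[OF p]])
    show "\<not> (\<lambda>(k, q). \<not> (k = 0 \<and> q \<in> fixfree j)) (0, p)"
      using p by simp
  next
    fix x assume x: "x \<in> pairs j (weight p) (j \<in> set p)" "(\<lambda>(k, q). q \<in> with_part (j + 2 * k + 1)) x"
    obtain k q where kq: "x = (k, q)" by (cases x)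
    have "q \<in> with_part (j + 2 * k + 1)"
      using x by (simp add: kq)
    then obtain k' q' where "psi j (k, q) = (k', q')" "q' \<in> partitions"
      "\<not> (k' = 0 \<and> q' \<in> fixfree j)"
      "phi j (k', q') = (k, q)" "weight (from_pair j (k', q')) = weight (from_pair j (k, q))"
      "j \<in> set q' \<longleftrightarrow> j \<in> set q"
      using psi_inverse by blast
    then show "psi j x \<in> pairs j (weight p) (j \<in> set p) \<and>
        (\<lambda>(k, q). \<not> (k = 0 \<and> q \<in> fixfree j)) (psi j x) \<and> phi j (psi j x) = x"
      using x by (simp add: kq pairs_def)
  qed blast
  then obtain k q where t: "(k, q) \<in> pairs j (weight p) (j \<in> set p)"
    "q \<notin> with_part (j + 2 * k + 1)" "Psi_run j p = Some (k, q)"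
    "while_option (\<lambda>(k, q). \<not> (k = 0 \<and> q \<in> fixfree j)) (phi j) (k, q) = Some (0, p)"
    by auto
  then have q: "q \<in> partitions - with_part (j + 2 * k + 1)" by (simp add: pairs_def)
  have Psi: "Psi j p = from_pair j (k, q)" using t by (simp add: Psi_def)
  have "Phi_run j (Psi j p) = Some (0, p)"
    unfolding Psi Phi_run_def to_pair_from_pair[OF q] by (fact t(4))
  then show "Phi j (Psi j p) = p" by (simp add: Phi_def)
  show "Psi_run j p \<noteq> None" "Psi j p \<in> odd_mex j" "weight (Psi j p) = weight p"
    "j \<in> set (Psi j p) \<longleftrightarrow> j \<in> set p"
    using t(1,3) from_pair_odd_mex[OF q] by (auto simp: Psi pairs_def set_Delta)
qed

section \<open>The maps \<open>\<Gamma>\<^sub>j\<close> and \<open>\<Gamma>\<^sub>j\<^sup>-\<^sup>1\<close>\<close>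

lemma partitions_replicate: "0 < c \<Longrightarrow> replicate n c \<in> partitions"
  by (induction n) (auto simp: partitions_def)

lemma count_list_replicate: "count_list (replicate n x) y = (if x = y then n else 0)"
  by (induction n) auto

lemma ones_at_end:
  assumes "p \<in> partitions"
  shows "p = filter (\<lambda>x. 1 < x) p @ replicate (num_ones p) 1"
proof (rule partitions_unique[OF assms])
  show "filter (\<lambda>x. 1 < x) p @ replicate (num_ones p) 1 \<in> partitions"
    using assms by (intro partitions_appendI[where c = 1] partitions_replicate)
      (auto simp: partitions_def sorted_wrt_filter)
  have "0 \<notin> set p" using assms by (simp add: partitions_def)
  then show "mset p = mset (filter (\<lambda>x. 1 < x) p @ replicate (num_ones p) 1)"
    by (induction p) (auto simp: num_ones_def)
qed

lemma filter_length_bound: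
  assumes "\<forall>y\<in>set ys. \<not> P y"
  shows "length (filter P (xs @ ys)) \<le> length xs"
  using assms by (simp add: filter_False)

text \<open>The image has at least \<open>d + j\<close> ones, and its parts after the first
  \<open>d\<close> are at most \<open>d + j\<close>. So at most \<open>d\<close> parts are large,
  and the crank is at most \<open>d - (d + j)\<close>. The image splits at the same
  \<open>d\<close>, so \<open>Gam_inv\<close> removes the right number of ones.\<close>

lemma Gam_props:
  assumes p: "p \<in> fixfree j" "p \<in> with_part j" "1 < weight p"
  shows "j \<noteq> 0 \<longrightarrow> j \<in> set (drop (durfee j p) p)" "Gam j p \<in> partitions"
    "weight (Gam j p) = weight p" "crank (Gam j p) \<le> - int j" "Gam_inv j (Gam j p) = p"
proof -
  obtain xs ys where s: "p = xs @ ys" and d: "durfee j p = length xs"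
    and xs: "\<forall>x\<in>set xs. length xs + j < x" and ys: "\<forall>y\<in>set ys. y \<le> length xs + j"
    using fixfree_split[OF p(1)] by metis
  have pp: "p \<in> partitions" using p(1) by (simp add: fixfree_def)
  then have ps: "xs \<in> partitions" "ys \<in> partitions" by (simp_all add: s partitions_append)
  define zs where "zs = (if j = 0 then ys else remove1 j ys)"
  let ?n = "length xs + j"
  let ?r = "map (\<lambda>x. x - 1) xs @ zs @ replicate ?n 1"
  have j: "j \<in> set ys" if "j \<noteq> 0" using that p(2) xs by (auto simp: with_part_def s)
  then show "j \<noteq> 0 \<longrightarrow> j \<in> set (drop (durfee j p) p)" using d by (simp add: s)
  have Gam: "Gam j p = ?r" using d by (simp add: Gam_def s zs_def)
  have zs: "zs \<in> partitions" "\<forall>y\<in>set zs. y \<le> ?n"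
    using ps ys by (auto simp: zs_def intro: partitions_remove1 dest: set_remove1_subset[THEN subsetD])
  \<comment> \<open>If \<open>d\<close> and \<open>j\<close> both vanished, no part could be
    positive. Hence the image contains a 1, and its crank is given by the difference
    formula.\<close>
  have n: "1 \<le> ?n"
  proof (rule ccontr)
    assume "\<not> 1 \<le> ?n"
    then have "length xs = 0" "j = 0" by linarith+
    then have "xs = []" "\<forall>y\<in>set ys. y = 0" using ys by auto
    then have "p = []" using ps by (cases ys) (auto simp: s partitions_def)
    then show False using p(3) by simp
  qed
  have tail: "zs @ replicate ?n 1 \<in> partitions"
    using zs(1) by (intro partitions_appendI[where c = 1] partitions_replicate)
      (auto simp: partitions_def Suc_le_eq intro: Nat.gr0I)
  have head: "map (\<lambda>x. x - 1) xs \<in> partitions"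
    using ps(1) xs n by (intro partitions_map_pred) auto
  have r: "?r \<in> partitions"
    by (rule partitions_appendI[where c = ?n, OF head tail]) (use xs zs n in fastforce)+
  then show "Gam j p \<in> partitions" by (simp add: Gam)
  have pos: "0 \<notin> set xs" using ps by (simp add: partitions_def)
  have wz: "weight zs + j = weight ys"
    using j weight_remove1[of j ys] by (auto simp: zs_def)
  show wt: "weight (Gam j p) = weight p"
    unfolding Gam using wz weight_map_pred[OF pos] by (simp add: s sum_list_replicate)
  have ones: "?n \<le> num_ones ?r"
    by (simp add: num_ones_def count_list_replicate)
  have "\<forall>y\<in>set (zs @ replicate ?n 1). \<not> num_ones ?r < y"
    using ones zs(2) n by (auto simp del: append.simps)
  then have "num_large ?r \<le> length xs"
    unfolding num_large_def by (metis filter_length_bound length_map)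
  then show "crank (Gam j p) \<le> - int j"
    using ones n by (auto simp: Gam crank_def)
  have durfee: "durfee j ?r = length xs"
    using durfee_append(1)[of "map (\<lambda>x. x - 1) xs" "zs @ replicate ?n 1" j] r xs zs n by fastforce
  have take: "take (length ?r - ?n) ?r = map (\<lambda>x. x - 1) xs @ zs"
    by simp
  have "insert_parts (if j = 0 then [] else [j]) (xs @ zs) = p"
  proof (rule insert_parts_eqI)
    show "sorted_wrt (\<ge>) p" using pp by (simp add: partitions_def)
    show "mset p = mset (if j = 0 then [] else [j]) + mset (xs @ zs)"
      using j by (auto simp: s zs_def)
  qed
  then show "Gam_inv j (Gam j p) = p"
    unfolding Gam_inv_def Gam durfee Let_def take using map_Suc_pred[OF pos] by simp
qed

lemma Gam_inv_props:
  assumes p: "p \<in> partitions" "1 < weight p" "crank p \<le> - int j"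
  shows "2 * durfee j p + j \<le> length p"
    "\<forall>x\<in>set (drop (length p - (durfee j p + j)) p). x = 1"
    "Gam_inv j p \<in> fixfree j" "Gam_inv j p \<in> with_part j"
    "weight (Gam_inv j p) = weight p" "Gam j (Gam_inv j p) = p"
proof -
  obtain xs ys where s: "p = xs @ ys" and d: "durfee j p = length xs"
    and xs: "\<forall>x\<in>set xs. length xs + j \<le> x" and ys: "\<forall>y\<in>set ys. y \<le> length xs + j"
    using durfee_split[OF p(1)] by metis
  let ?n = "length xs + j"
  let ?w = "num_ones p"
  have ne: "p \<noteq> []" using p(2) by auto
  have "part p 1 \<noteq> 0" using p(1) ne by (cases p) (auto simp: partitions_def part_def)
  \<comment> \<open>Without ones the crank would be the largest part, which is positive.\<close>
  then have w: "0 < ?w"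
    using p(3) ne by (auto simp: crank_def split: if_splits)
  have large: "int (num_large p) \<le> int ?w - int j"
    using p(3) w ne by (auto simp: crank_def split: if_splits)
  \<comment> \<open>Otherwise the first \<open>d\<close> parts, all at least \<open>d + j\<close>,
    would be large, and the crank would exceed \<open>- j\<close>.\<close>
  have n: "?n \<le> ?w"
  proof (rule ccontr)
    assume *: "\<not> ?n \<le> ?w"
    have "filter (\<lambda>x. ?w < x) xs = xs"
      using xs * by (intro filter_True) auto
    then have "length xs \<le> num_large p"
      by (simp add: num_large_def s)
    then show False using large * by simp
  qed
  \<comment> \<open>The ones to be deleted must lie beyond the first \<open>d\<close> parts. A 1
    among these forces \<open>d = 1\<close> and \<open>j = 0\<close>, and then
    \<open>1 < weight p\<close> supplies a further part.\<close>
  have len: "?n \<le> length ys"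
  proof (cases "1 \<in> set xs")
    case True
    then have x1: "length xs = 1" "j = 0"
      using xs by (cases xs; fastforce)+
    then have "xs = [1]" using True by (cases xs) auto
    then have "ys \<noteq> []" using p(2) by (auto simp: s)
    then show ?thesis using x1 by (cases ys) auto
  next
    case False
    then have "?w = count_list ys 1"
      by (simp add: num_ones_def s)
    then show ?thesis using n count_le_length[of ys 1] by simp
  qed
  then show "2 * durfee j p + j \<le> length p" using d s by simp
  define zs where "zs = take (length ys - ?n) ys"
  have dr: "drop (length p - ?n) p = replicate ?n 1"
  proof -
    have "drop (length p - ?n) p = drop (length p - ?n) (filter (\<lambda>x. 1 < x) p @ replicate ?w 1)"
      using ones_at_end[OF p(1)] by simp
    moreover have "length p = length (filter (\<lambda>x. 1 < x) p) + ?w"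
      using arg_cong[OF ones_at_end[OF p(1)], of length] by simp
    ultimately show ?thesis using n by simp
  qed
  then show "\<forall>x\<in>set (drop (length p - (durfee j p + j)) p). x = 1"
    by (simp add: d)
  have "drop (length ys - ?n) ys = replicate ?n 1"
    using dr len by (simp add: s add.commute)
  then have yz: "ys = zs @ replicate ?n 1"
    unfolding zs_def by (metis append_take_drop_id)
  have ps: "xs \<in> partitions" "zs \<in> partitions" "\<forall>y\<in>set zs. y \<le> ?n"
    using p(1) ys by (auto simp: s yz partitions_append)
  let ?zs = "insert_parts (if j = 0 then [] else [j]) zs"
  have pz: "?zs \<in> partitions" using ps by (simp add: partitions_insert_parts)
  have r: "map Suc xs @ ?zs \<in> partitions"
    by (rule partitions_appendI[where c = ?n, OF partitions_map_Suc[OF ps(1)] pz])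
      (use xs ps in \<open>auto split: if_splits intro: le_SucI\<close>)
  have inv: "Gam_inv j p = map Suc xs @ ?zs"
  proof -
    have "take (length p - ?n) p = xs @ zs" by (simp add: s yz)
    moreover have "insert_parts (if j = 0 then [] else [j]) (map Suc xs @ zs) = map Suc xs @ ?zs"
      by (rule insert_parts_eqI) (use r in \<open>auto simp: partitions_def\<close>)
    ultimately show ?thesis by (simp add: Gam_inv_def d Let_def del: take_take)
  qed
  have xs': "\<forall>x\<in>set (map Suc xs). length (map Suc xs) + j < x" using xs by auto
  have zs': "\<forall>y\<in>set ?zs. y \<le> length (map Suc xs) + j" using ps by auto
  \<comment> \<open>The raised parts exceed \<open>d + j\<close> strictly, so the image has no fixed
    part, and \<open>d\<close> stays the same.\<close>
  note fx = durfee_fixfree[OF r xs' zs']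
  show "Gam_inv j p \<in> fixfree j" using fx by (simp add: inv)
  show "Gam_inv j p \<in> with_part j" using r by (simp add: with_part_def inv)
  show "weight (Gam_inv j p) = weight p"
    unfolding inv by (simp add: s yz weight_map_Suc sum_list_replicate)
  have "(if j = 0 then ?zs else remove1 j ?zs) = zs"
    using ps(2) by (auto simp: insert_parts_empty remove1_insert_parts partitions_def)
  then show "Gam j (Gam_inv j p) = p"
    unfolding inv using fx by (simp add: Gam_def Let_def s yz map_pred_Suc[simplified] split: if_splits)
qed

section \<open>Conjugate parts\<close>

lemma conj_part_eq_length: "conj_part p i = length (filter ((\<le>) i) p)"
proof -
  have "{u. 1 \<le> u \<and> u \<le> length p \<and> i \<le> part p u} = Suc ` {u. u < length p \<and> i \<le> p ! u}"
    by (auto simp: image_iff part_def Suc_le_eq gr0_conv_Suc)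
  then show ?thesis
    by (simp add: conj_part_def length_filter_conv_card card_image)
qed

lemma part_Cons: "part (x # p) (Suc v) = (if v = 0 then x else part p v)"
  by (cases v) (auto simp: part_def)

text \<open>The parts that are at least \<open>i\<close> form an initial segment. Both sides say
  that the cell in row \<open>u\<close> and column \<open>i\<close> belongs to the Young
  diagram.\<close>

lemma le_conj_part_iff:
  assumes "p \<in> partitions" "1 \<le> u" "1 \<le> i"
  shows "u \<le> conj_part p i \<longleftrightarrow> i \<le> part p u"
  using assms
proof (induction p arbitrary: u)
  case Nil
  then show ?case by (simp add: conj_part_eq_length part_def)
next
  case (Cons x p)
  have pos: "0 < x" "p \<in> partitions" and le: "\<forall>y\<in>set p. y \<le> x"
    using Cons.prems by (auto simp: partitions_Cons)
  have small: "filter ((\<le>) i) p = []" if "x < i"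
    using le that by (auto simp: filter_empty_conv)
  obtain v where v: "u = Suc v" using Cons.prems(2) by (cases u) auto
  have "part p v \<le> x"
    using le by (auto simp: part_def)
  then show ?case
    using Cons.IH[OF pos(2), of v] Cons.prems(3) small
    by (cases "v = 0"; cases "i \<le> x") (auto simp: conj_part_eq_length part_Cons v)
qed

lemma conj_part_eqI:
  assumes "p \<in> partitions" "1 \<le> i" "\<And>u. 1 \<le> u \<Longrightarrow> i \<le> part p u \<longleftrightarrow> u \<le> n"
  shows "conj_part p i = n"
proof -
  have "u \<le> conj_part p i \<longleftrightarrow> u \<le> n" for u
    using le_conj_part_iff[OF assms(1) _ assms(2), of u] assms(3)[of u] by (cases "u = 0") auto
  then show ?thesis by (metis order_antisym order_refl)
qed

lemma conj_part_antimono: "i \<le> i' \<Longrightarrow> conj_part p i' \<le> conj_part p i"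
  by (induction p) (auto simp: conj_part_eq_length)

lemma conj_part_1: "p \<in> partitions \<Longrightarrow> conj_part p 1 = length p"
  unfolding conj_part_eq_length
  by (subst filter_True) (auto simp: partitions_def Suc_le_eq intro!: Nat.gr0I)

lemma conj_part_1_2: "p \<in> partitions \<Longrightarrow> conj_part p 1 = conj_part p 2 + num_ones p"
  by (induction p) (auto simp: conj_part_eq_length num_ones_def partitions_Cons)

lemma num_large_eq_conj_part: "num_large p = conj_part p (num_ones p + 1)"
  by (simp add: num_large_def conj_part_eq_length Suc_le_eq[abs_def])

text \<open>The cells of the Young diagram are counted by columns instead of rows.\<close>

lemma weight_eq_sum_conj_part:
  "\<forall>x\<in>set p. x \<le> n \<Longrightarrow> weight p = (\<Sum>i=1..n. conj_part p i)"
proof (induction p)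
  case (Cons x p)
  have "conj_part (x # p) i = (if i \<le> x then 1 else 0) + conj_part p i" for i
    by (simp add: conj_part_eq_length)
  moreover have "(\<Sum>i=1..n. if i \<le> x then 1 else 0) = x"
  proof -
    have "{1..n} \<inter> {i. i \<le> x} = {1..x}" using Cons.prems by auto
    then show ?thesis by (simp add: sum.If_cases)
  qed
  ultimately show ?case using Cons by (simp add: sum.distrib)
qed (simp add: conj_part_eq_length)

text \<open>Parts are positive and \<open>part\<close> is 0 beyond the end, so the values of
  \<open>part\<close> also determine the length.\<close>

lemma part_eqI:
  assumes "p \<in> partitions" "q \<in> partitions" "\<And>u. 1 \<le> u \<Longrightarrow> part p u = part q u"
  shows "p = q"
proof (rule nth_equalityI)
  have "conj_part p 1 = conj_part q 1"
    by (rule conj_part_eqI[OF assms(1)]) (use le_conj_part_iff[OF assms(2)] assms(3) in auto)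
  then show len: "length p = length q"
    using assms by (simp add: conj_part_1 flip: One_nat_def)
  show "p ! i = q ! i" if "i < length p" for i
    using assms(3)[of "Suc i"] that len by (simp add: part_Suc)
qed

section \<open>The map \<open>\<Lambda>\<close>\<close>

text \<open>The case with \<omega> and \<eta> both positive, where \<open>r\<close> is \<rho>. With
  \<open>w\<close>, \<open>e\<close> and \<open>r\<close> as parameters, the locale can be
  interpreted again at \<open>Lam p\<close> with \<open>w\<close> and \<open>e\<close>
  exchanged.\<close>

locale Lam_generic =
  fixes p w e r
  assumes p: "p \<in> partitions"
    and w_def: "w = num_ones p" and e_def: "e = num_large p"
    and r_def: "r = max w (part p 2 - 1)"
    and w_pos: "0 < w" and e_pos: "0 < e"
begin

lemma e_eq: "conj_part p (w + 1) = e"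
  using num_large_eq_conj_part[of p] by (simp add: w_def e_def)

lemma le_conj_iff: "1 \<le> u \<Longrightarrow> 1 \<le> i \<Longrightarrow> u \<le> conj_part p i \<longleftrightarrow> i \<le> part p u"
  by (rule le_conj_part_iff[OF p])

lemma w_le_r: "w \<le> r"
  by (simp add: r_def)

lemma part_2: "part p 2 \<le> r + 1"
  by (simp add: r_def)

text \<open>A large part exists, so the first part exceeds \<open>w\<close>; being positive and at
  least \<open>part p 2\<close>, it also exceeds \<open>part p 2 - 1\<close>.\<close>

lemma part_1: "r < part p 1"
proof -
  have "w + 1 \<le> part p 1" using le_conj_iff[of 1 "w + 1"] e_eq e_pos by simp
  moreover have "part p 2 \<le> part p 1" using part_antimono[OF p, of 1 2] by simp
  ultimately show ?thesis by (auto simp: r_def)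
qed

lemma e_le: "e \<le> conj_part p 2"
  using conj_part_antimono[of 2 "w + 1" p] w_pos e_eq by simp

lemma Lam_eq: "Lam p = map (\<lambda>i. if i = 1 then conj_part p 2 + part p 1 - r
                   else if i \<le> w then 1 + conj_part p i
                   else if i \<le> r then conj_part p (i + 1)
                   else 1) [1..<r + e + 1]"
  unfolding Lam_def Let_def w_def[symmetric] e_def[symmetric] r_def[symmetric]
  using w_pos e_pos by (simp del: upt_Suc)

lemma part_Lam:
  assumes "1 \<le> i"
  shows "part (Lam p) i = (if i = 1 then conj_part p 2 + (part p 1 - r)
                   else if i \<le> w then 1 + conj_part p i
                   else if i \<le> r then conj_part p (i + 1)
                   else if i \<le> r + e then 1 else 0)"
proof (cases "i \<le> r + e")
  case True
  then have "[1..<r + e + 1] ! (i - 1) = i"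
    using assms by (subst nth_upt) auto
  then show ?thesis
    using True assms part_1 by (simp add: part_def Lam_eq del: upt_Suc)
next
  case False
  then show ?thesis
    using assms w_le_r w_pos by (auto simp: part_def Lam_eq simp del: upt_Suc)
qed

lemma length_Lam: "length (Lam p) = r + e"
  by (simp add: Lam_eq del: upt_Suc)

text \<open>Such an index exists only if \<open>r = part p 2 - 1\<close>, so the first two parts are
  at least \<open>i + 1\<close>.\<close>

lemma conj_ge_2: "2 \<le> conj_part p (i + 1)" if "w < i" "i \<le> r"
  using le_conj_iff[of 2 "i + 1"] that by (auto simp: r_def)

lemma conj_ge_1: "1 \<le> conj_part p i" if "1 \<le> i" "i \<le> r + 1"
  using le_conj_iff[of 1 i] that part_1 by auto

lemma Lam_partition: "Lam p \<in> partitions"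
proof -
  have step: "part (Lam p) (Suc u) \<le> part (Lam p) u" if u: "1 \<le> u" for u
  proof -
    have "conj_part p (Suc u) \<le> conj_part p u" "conj_part p (Suc (Suc u)) \<le> conj_part p u"
      "conj_part p (Suc (Suc u)) \<le> conj_part p (Suc u)"
      by (simp_all add: conj_part_antimono)
    \<comment> \<open>For \<open>w = 1 < r\<close> the first entry is followed directly by
      \<open>conj_part p 3\<close>.\<close>
    moreover have "conj_part p 3 \<le> conj_part p 2"
      by (simp add: conj_part_antimono)
    ultimately show ?thesis
      using u part_1 w_le_r w_pos e_le e_pos conj_ge_1[of "Suc u"]
      by (auto simp: part_Lam numeral_eq_Suc)
  qed
  have "sorted_wrt (\<ge>) (Lam p)"
    by (subst sorted_wrt_iff_nth_Suc_transp)
      (use step in \<open>auto simp: transp_def simp flip: part_Suc\<close>)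
  moreover have "0 < part (Lam p) u" if "1 \<le> u" "u \<le> r + e" for u
    using that part_1 conj_ge_1[of "u + 1"] by (auto simp: part_Lam)
  then have "0 \<notin> set (Lam p)"
    by (fastforce simp: in_set_conv_nth length_Lam Suc_le_eq simp flip: part_Suc)
  ultimately show ?thesis by (simp add: partitions_def)
qed

lemma conj_Lam_2: "conj_part (Lam p) 2 = r"
proof (rule conj_part_eqI[OF Lam_partition])
  show "2 \<le> part (Lam p) u \<longleftrightarrow> u \<le> r" if "1 \<le> u" for u
    using that part_1 w_le_r w_pos e_le e_pos conj_ge_1[of u] conj_ge_2[of u] by (auto simp: part_Lam)
qed simp

lemma num_ones_Lam: "num_ones (Lam p) = e"
  using conj_part_1_2[OF Lam_partition] conj_part_1[OF Lam_partition]
  by (simp add: conj_Lam_2 length_Lam)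

text \<open>The skipped conjugate part, of size \<open>e\<close>, is the dividing line: entries up
  to position \<open>w\<close> exceed it, and later ones are conjugate parts of higher index or
  1.\<close>

lemma num_large_Lam: "num_large (Lam p) = w"
  unfolding num_large_eq_conj_part num_ones_Lam
proof (rule conj_part_eqI[OF Lam_partition])
  show "e + 1 \<le> part (Lam p) u \<longleftrightarrow> u \<le> w" if "1 \<le> u" for u
    using that part_1 w_le_r w_pos e_le e_pos e_eq conj_part_antimono[of u "w + 1" p]
      conj_part_antimono[of "w + 1" "u + 1" p]
    by (auto simp: part_Lam)
qed simp

text \<open>This maximum is \<open>\<rho>\<close> for \<open>Lam p\<close>.\<close>
lemma r_Lam: "max e (part (Lam p) 2 - 1) = conj_part p 2"
proof (cases "w = 1")
  case True
  then have "e = conj_part p 2" using e_eq by (simp add: numeral_2_eq_2)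
  then show ?thesis
    using True conj_part_antimono[of 2 3 p] by (auto simp: part_Lam)
next
  case False
  then show ?thesis using w_pos e_le by (simp add: part_Lam)
qed

text \<open>The weight of \<open>p\<close> is the sum of its conjugate parts. Of these, the first is the second plus
  \<open>w\<close>, the one with index \<open>w + 1\<close>, which \<open>Lam\<close> skips, is \<open>e\<close>, and those with index from
  \<open>r + 2\<close> to \<open>part p 1\<close> are 1.\<close>
lemma weight_Lam: "weight (Lam p) = weight p"
proof -
  let ?c = "conj_part p"
  define P where "P = part p 1"
  have P: "r < P" using part_1 by (simp add: P_def)
  have rw: "w \<le> r" "1 \<le> w" using w_le_r w_pos by auto
  have "x \<le> P" if x: "x \<in> set p" for x
  proof -
    obtain i where "i < length p" "x = p ! i" using x by (auto simp: in_set_conv_nth)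
    then show ?thesis using part_antimono[OF p, of 1 "Suc i"] by (simp add: P_def part_Suc)
  qed
  then have "weight p = (\<Sum>i=1..P. ?c i)" by (intro weight_eq_sum_conj_part) blast
  also have "\<dots> = (\<Sum>i=1..<P+1. ?c i)" by (intro sum.cong) auto
  also have "\<dots> = ?c 1 + (\<Sum>i=2..<r+2. ?c i) + (\<Sum>i=r+2..<P+1. ?c i)"
    using P rw by (subst sum.atLeastLessThan_concat[symmetric, of 1 2], simp, simp,
        subst sum.atLeastLessThan_concat[symmetric, of 2 "r+2"]) (simp_all add: numeral_2_eq_2)
  also have "(\<Sum>i=r+2..<P+1. ?c i) = (\<Sum>i=r+2..<P+1. 1)"
  proof (rule sum.cong[OF refl])
    fix i assume "i \<in> {r+2..<P+1}"
    then show "?c i = 1"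
      using le_conj_iff[of 1 i] le_conj_iff[of 2 i] part_2 by (auto simp: P_def)
  qed
  also have "(\<Sum>i=2..<r+2. ?c i) = (\<Sum>i=2..<w+1. ?c i) + e + (\<Sum>i=w+2..<r+2. ?c i)"
    using rw by (subst sum.atLeastLessThan_concat[symmetric, of 2 "w+1"], simp, simp,
        subst sum.atLeastLessThan_concat[symmetric, of "w+1" "w+2"]) (simp_all add: flip: e_eq)
  finally have wp: "weight p = ?c 2 + w + ((\<Sum>i=2..<w+1. ?c i) + e + (\<Sum>i=w+2..<r+2. ?c i)) + (P - (r + 1))"
    using conj_part_1_2[OF p] by (simp add: w_def)
  let ?n = "part (Lam p)"
  have "weight (Lam p) = (\<Sum>i<r+e. Lam p ! i)"
    by (simp add: sum_list_sum_nth length_Lam atLeast0LessThan)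
  also have "\<dots> = (\<Sum>i=0..<r+e. ?n (Suc i))"
    by (intro sum.cong) (auto simp: part_Suc length_Lam)
  also have "\<dots> = (\<Sum>i=1..<r+e+1. ?n i)"
    by (subst sum.shift_bounds_Suc_ivl[symmetric]) simp
  also have "\<dots> = ?n 1 + (\<Sum>i=2..<w+1. ?n i) + (\<Sum>i=w+1..<r+1. ?n i) + (\<Sum>i=r+1..<r+e+1. ?n i)"
    using rw by (subst sum.atLeastLessThan_concat[symmetric, of 1 2], simp, simp,
        subst sum.atLeastLessThan_concat[symmetric, of 2 "w+1"], simp, simp,
        subst sum.atLeastLessThan_concat[symmetric, of "w+1" "r+1"]) (simp_all add: numeral_2_eq_2)
  also have "(\<Sum>i=2..<w+1. ?n i) = (\<Sum>i=2..<w+1. 1 + ?c i)"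
    by (intro sum.cong) (auto simp: part_Lam)
  also have "(\<Sum>i=w+1..<r+1. ?n i) = (\<Sum>i=w+1..<r+1. ?c (Suc i))"
    using rw by (intro sum.cong) (auto simp: part_Lam)
  also have "\<dots> = (\<Sum>i=w+2..<r+2. ?c i)"
    by (subst sum.shift_bounds_Suc_ivl[symmetric]) simp
  also have "(\<Sum>i=r+1..<r+e+1. ?n i) = (\<Sum>i=r+1..<r+e+1. 1)"
    using rw by (intro sum.cong) (auto simp: part_Lam)
  also have "?n 1 = ?c 2 + (P - r)" by (simp add: part_Lam P_def)
  finally have "weight (Lam p) = ?c 2 + (P - r) + (w - 1 + (\<Sum>i=2..<w+1. ?c i)) +
      (\<Sum>i=w+2..<r+2. ?c i) + e"
    by (simp add: sum_Suc del: sum.op_ivl_Suc)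
  then show ?thesis unfolding wp using P rw by simp
qed

text \<open>The new \<rho> is \<open>conj_part p 2\<close>, and by \<open>conj_Lam_2\<close> a
  second exchange brings back \<open>r\<close>.\<close>

lemma Lam_generic_Lam: "Lam_generic (Lam p) e w (conj_part p 2)"
  by unfold_locales (use Lam_partition num_ones_Lam num_large_Lam r_Lam w_pos e_pos in simp_all)

lemma Lam_Lam: "Lam (Lam p) = p"
proof -
  interpret L: Lam_generic "Lam p" e w "conj_part p 2"
    by (rule Lam_generic_Lam)
  let ?c = "conj_part p" and ?n = "part (Lam p)"
  have rw: "w \<le> r" "1 \<le> w" and P: "r < part p 1" using w_le_r w_pos part_1 by auto
  have part_le: "part p i \<le> r + 1" if "2 \<le> i" for i
    using part_antimono[OF p, of 2 i] part_2 that by simp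
  have large: "w + 1 \<le> part p i \<longleftrightarrow> i \<le> e" if "1 \<le> i" for i
    using le_conj_iff[of i "w + 1"] that e_eq by simp
  have c_gt: "e \<le> ?c u" if "u \<le> w" for u
    using conj_part_antimono[of u "w + 1" p] that e_eq by simp
  have c_le: "?c (Suc u) \<le> e" if "w < u" for u
    using conj_part_antimono[of "w + 1" "Suc u" p] that e_eq by simp
  show ?thesis
  proof (rule part_eqI[OF L.Lam_partition p])
    fix i :: nat assume i: "1 \<le> i"
    \<comment> \<open>These are the ranges in \<open>L.part_Lam\<close>, with \<open>e\<close> and
      \<open>conj_part p 2\<close> in place of \<open>w\<close> and \<open>r\<close>.\<close>
    consider "i = 1" | "2 \<le> i" "i \<le> e" | "2 \<le> i" "e < i" "i \<le> ?c 2" | "?c 2 < i" "2 \<le> i"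
      using i by linarith
    then show "part (Lam (Lam p)) i = part p i"
    proof cases
      case 1
      then show ?thesis using P part_Lam[of 1] by (simp add: L.part_Lam conj_Lam_2)
    next
      case 2
      have "conj_part (Lam p) i = part p i - 1"
      proof (rule conj_part_eqI[OF Lam_partition])
        fix u :: nat assume u: "1 \<le> u"
        \<comment> \<open>Since \<open>part p i > w\<close>, the skipped column \<open>w + 1\<close>
          is among those reaching row \<open>i\<close>, which lowers the count by one.\<close>
        have "i \<le> ?n u \<longleftrightarrow> u + 1 \<le> part p i"
          using 2 u rw P e_le large[of i] c_gt[of u] part_le[of i] le_conj_iff[of i "u + 1"]
          by (auto simp: part_Lam)
        then show "i \<le> ?n u \<longleftrightarrow> u \<le> part p i - 1" using u by auto
      qed (use 2 in simp)
      then show ?thesis using 2 i large[of i] by (simp add: L.part_Lam)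
    next
      case 3
      have "conj_part (Lam p) (i + 1) = part p i"
      proof (rule conj_part_eqI[OF Lam_partition])
        fix u :: nat assume u: "1 \<le> u"
        \<comment> \<open>Since \<open>i > e\<close>, entries beyond position \<open>w\<close> stay
          below \<open>i + 1\<close>; at positions from 2 to \<open>w\<close> the added 1 offsets
          the shift from \<open>i\<close> to \<open>i + 1\<close>.\<close>
        show "i + 1 \<le> ?n u \<longleftrightarrow> u \<le> part p i"
          using 3 u rw P large[of i] c_le[of u] le_conj_iff[of i u] le_conj_iff[of i 1] le_conj_iff[of i 2]
          by (auto simp: part_Lam)
      qed simp
      then show ?thesis using 3 i by (simp add: L.part_Lam)
    next
      case 4
      \<comment> \<open>Beyond row \<open>conj_part p 2\<close> only the \<open>w\<close> parts
        equal to 1 remain.\<close>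
      have "part p i < 2" using le_conj_iff[of i 2] 4 by simp
      moreover have "1 \<le> part p i \<longleftrightarrow> i \<le> ?c 2 + w"
        using le_conj_iff[of i 1] i conj_part_1_2[OF p] by (simp add: w_def)
      ultimately show ?thesis using 4 e_le by (auto simp: L.part_Lam)
    qed
  qed
qed

end

text \<open>The degenerate cases, no ones or no large parts, are inverse to each other: a largest
  part is traded for ones and back. In the generic case, exchanging \<omega> and \<eta> negates the
  crank.\<close>

lemma Lam_props:
  assumes p: "p \<in> partitions" "1 < weight p"
  shows "Lam p \<in> partitions" "weight (Lam p) = weight p" "crank (Lam p) = - crank p" "Lam (Lam p) = p"
proof -
  have ne: "p \<noteq> []" using p(2) by auto
  have "Lam p \<in> partitions \<and> weight (Lam p) = weight p \<and> crank (Lam p) = - crank p \<and> Lam (Lam p) = p"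
  proof (cases "num_ones p = 0")
    case True
    obtain x q where pq: "p = x # q" using ne by (cases p) auto
    have x: "0 < x" "q \<in> partitions" "\<forall>y\<in>set q. y \<le> x" using p pq by (auto simp: partitions_Cons)
    have q: "num_ones q = 0" "x \<noteq> 1" using True by (auto simp: pq num_ones_def split: if_splits)
    have Lam: "Lam p = q @ replicate x 1"
      using True by (simp add: Lam_def pq part_def)
    have ones: "num_ones (q @ replicate x 1) = x" using q by (simp add: num_ones_def count_list_replicate)
    have large: "num_large (q @ replicate x 1) = 0"
      unfolding num_large_def ones using x by (auto simp: filter_empty_conv)
    have pos: "0 \<notin> set q" using x by (simp add: partitions_def)
    have "Lam p \<in> partitions" unfolding Lam
      by (rule partitions_append[THEN iffD2])
        (use x pos in \<open>auto intro: partitions_replicate simp: Suc_le_eq intro!: Nat.gr0I\<close>)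
    moreover have "weight (Lam p) = weight p" unfolding Lam by (simp add: pq sum_list_replicate)
    moreover have "crank (Lam p) = - crank p"
      unfolding Lam crank_def ones large using True x by (simp add: pq part_def)
    moreover have "Lam (Lam p) = p"
    proof -
      have "filter (\<lambda>x. x \<noteq> 1) q = q"
        using q by (intro filter_True) (auto simp: num_ones_def count_list_0_iff)
      then have "Lam (q @ replicate x 1) = x # q"
        unfolding Lam_def Let_def ones large using x q by simp
      then show ?thesis using Lam pq by simp
    qed
    ultimately show ?thesis by blast
  next
    case w: False
    show ?thesis
    proof (cases "num_large p = 0")
      case True
      define w where "w = num_ones p"
      define q where "q = filter (\<lambda>x. x \<noteq> 1) p"
      \<comment> \<open>This bound makes \<open>w\<close> a legitimate first part. It also excludes
        \<open>w = 1\<close>, where the only part would be a single 1.\<close>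
      have le: "\<forall>y\<in>set p. y \<le> w" using True by (auto simp: num_large_def filter_empty_conv w_def)
      have "w \<noteq> 1"
      proof
        assume "w = 1"
        then have "\<forall>y\<in>set p. y = 1"
          using le p(1) by (auto simp: partitions_def le_Suc_eq)
        then have "filter ((<) 1) p = []"
          by (simp add: filter_empty_conv)
        then have "p = replicate w 1"
          using ones_at_end[OF p(1)] by (simp add: w_def)
        from arg_cong[OF this, of weight] show False
          using p(2) \<open>w = 1\<close> by simp
      qed
      then have w2: "2 \<le> w" using w by (simp add: w_def)
      have pos: "0 \<notin> set p" using p(1) by (simp add: partitions_def)
      have Lam: "Lam p = w # q" using True w by (simp add: Lam_def w_def q_def)
      have q: "q \<in> partitions" "\<forall>y\<in>set q. y \<le> w" "num_ones q = 0"
        using p(1) le by (auto simp: q_def partitions_def sorted_wrt_filter num_ones_def)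
      have "Lam p \<in> partitions" using q w2 by (simp add: Lam partitions_Cons)
      moreover have "q = filter ((<) 1) p"
        unfolding q_def by (rule filter_cong) (use pos in \<open>auto intro!: Suc_lessI Nat.gr0I\<close>)
      then have p_eq: "p = q @ replicate w 1" using ones_at_end[OF p(1)] by (simp add: w_def)
      moreover have "weight (Lam p) = weight p"
        by (subst p_eq) (simp add: Lam sum_list_replicate)
      moreover have "crank (Lam p) = - crank p"
        using True w ne q(3) w2 by (auto simp: crank_def Lam num_ones_def part_def w_def)
      moreover have "Lam (Lam p) = p"
        using q(3) w2 by (subst p_eq) (auto simp: Lam Lam_def[of "w # q"] num_ones_def part_def)
      ultimately show ?thesis by blast
    next
      case False
      interpret Lam_generic p "num_ones p" "num_large p" "max (num_ones p) (part p 2 - 1)"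
        by unfold_locales (use p w False in auto)
      have "Lam p \<noteq> []" using length_Lam e_pos by auto
      then show ?thesis
        using ne w False Lam_partition weight_Lam Lam_Lam num_ones_Lam num_large_Lam
        by (simp add: crank_def)
    qed
  qed
  then show "Lam p \<in> partitions" "weight (Lam p) = weight p" "crank (Lam p) = - crank p"
    "Lam (Lam p) = p"
    by auto
qed

section \<open>The composition\<close>

theorem mainTheorem3:
  fixes j :: nat
  defines "A \<equiv> {p \<in> odd_mex j \<inter> with_part j. weight p > 1}"
    and "B \<equiv> {p \<in> fixfree j \<inter> with_part j. weight p > 1}"
    and "C \<equiv> {p \<in> partitions. weight p > 1 \<and> crank p \<le> - int j}"
    and "D \<equiv> {p \<in> partitions. weight p > 1 \<and> crank p \<ge> int j}"
  shows
    \<comment> \<open>the identification of the partitions in \<open>odd_mex j\<close> with pairs\<close>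
    "bij_betw (to_pair j) (odd_mex j) {(k, p). p \<in> partitions - with_part (j + 2 * k + 1)} \<and>
     (\<forall>p \<in> odd_mex j. from_pair j (to_pair j p) = p) \<and>
    \<comment> \<open>\<open>phi\<close> is well defined: the part to be deleted exists, the result is a pair\<close>
     (\<forall>k. \<forall>p \<in> partitions. \<not> (k = 0 \<and> p \<in> fixfree j) \<longrightarrow>
        (let m = j + 2 * k; d = durfee m p in
           (p \<notin> fixfree m \<longrightarrow> 1 \<le> d \<and> part p d = d + m) \<and>
           phi j (k, p) \<in> UNIV \<times> partitions)) \<and>
    \<comment> \<open>\<open>psi\<close> is well defined\<close>
     (\<forall>k. \<forall>p \<in> with_part (j + 2 * k + 1).
        (let m = j + 2 * k + 1; d = durfee m p in
           (p \<notin> fixfree m \<longrightarrow> 1 \<le> d \<and> part p d = d + m) \<and>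
           m \<in> set (drop d p) \<and>
           psi j (k, p) \<in> UNIV \<times> partitions)) \<and>
    \<comment> \<open>the iterations terminate, and \<open>Phi\<close> and \<open>Psi\<close> have the stated codomains\<close>
     (\<forall>p \<in> odd_mex j. Phi_run j p \<noteq> None \<and> Phi j p \<in> fixfree j) \<and>
     (\<forall>p \<in> fixfree j. Psi_run j p \<noteq> None \<and> Psi j p \<in> odd_mex j) \<and>
    \<comment> \<open>\<open>Gam\<close>, \<open>Gam_inv\<close> and \<open>Lam\<close> are well defined\<close>
     (\<forall>p \<in> B. (j \<noteq> 0 \<longrightarrow> j \<in> set (drop (durfee j p) p)) \<and> Gam j p \<in> partitions) \<and>
     (\<forall>p \<in> C. (let d = durfee j p; n = d + j in
        d + n \<le> length p \<and> (\<forall>x \<in> set (drop (length p - n) p). x = 1)) \<and>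
        Gam_inv j p \<in> partitions) \<and>
     (\<forall>p \<in> partitions. weight p > 1 \<longrightarrow> Lam p \<in> partitions) \<and>
    \<comment> \<open>the maps can be composed\<close>
     Phi j ` A \<subseteq> B \<and> Gam j ` B \<subseteq> C \<and> Lam ` C \<subseteq> D \<and>
     Lam ` D \<subseteq> C \<and> Gam_inv j ` C \<subseteq> B \<and> Psi j ` B \<subseteq> A \<and>
    \<comment> \<open>the composition is a weight-preserving bijection with the stated inverse\<close>
     bij_betw (Lam \<circ> Gam j \<circ> Phi j) A D \<and>
     (\<forall>p \<in> A. weight ((Lam \<circ> Gam j \<circ> Phi j) p) = weight p) \<and>
     (\<forall>p \<in> A. (Psi j \<circ> Gam_inv j \<circ> Lam) ((Lam \<circ> Gam j \<circ> Phi j) p) = p) \<and>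
     (\<forall>q \<in> D. (Lam \<circ> Gam j \<circ> Phi j) ((Psi j \<circ> Gam_inv j \<circ> Lam) q) = q)"
proof -
  \<comment> \<open>The condition \<open>with_part j\<close> is unfolded to match the invariant on
    \<open>j\<close> in \<open>Phi_props\<close> and \<open>Psi_props\<close>.\<close>
  have A: "p \<in> A \<longleftrightarrow> p \<in> odd_mex j \<and> (j = 0 \<or> j \<in> set p) \<and> 1 < weight p" for p
    by (auto simp: A_def with_part_def odd_mex_def)
  have B: "p \<in> B \<longleftrightarrow> p \<in> fixfree j \<and> (j = 0 \<or> j \<in> set p) \<and> 1 < weight p" for p
    by (auto simp: B_def with_part_def fixfree_def)
  have B': "p \<in> fixfree j" "p \<in> with_part j" "1 < weight p" if "p \<in> B" for p
    using that by (auto simp: B_def)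
  have C: "p \<in> partitions" "1 < weight p" "crank p \<le> - int j" if "p \<in> C" for p
    using that by (auto simp: C_def)
  have D: "p \<in> partitions" "1 < weight p" "int j \<le> crank p" if "p \<in> D" for p
    using that by (auto simp: D_def)
  have Phi: "Phi j p \<in> B" "Psi j (Phi j p) = p" "weight (Phi j p) = weight p" if "p \<in> A" for p
    using that Phi_props[of p j] by (auto simp: A B)
  have Psi: "Psi j p \<in> A" "Phi j (Psi j p) = p" if "p \<in> B" for p
    using that Psi_props[of p j] by (auto simp: A B)
  have Gam: "Gam j p \<in> C" "Gam_inv j (Gam j p) = p" "weight (Gam j p) = weight p" if "p \<in> B" for p
    using Gam_props[OF B'[OF that]] B'(3)[OF that] by (auto simp: C_def)
  have Gam_inv: "Gam_inv j p \<in> B" "Gam j (Gam_inv j p) = p" if "p \<in> C" for p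
    using Gam_inv_props[OF C[OF that]] C(2)[OF that] by (auto simp: B_def)
  have Lam_C: "Lam p \<in> D" "Lam (Lam p) = p" "weight (Lam p) = weight p" if "p \<in> C" for p
    using Lam_props[OF C(1,2)[OF that]] C[OF that] by (auto simp: D_def)
  have Lam_D: "Lam p \<in> C" "Lam (Lam p) = p" if "p \<in> D" for p
    using Lam_props[OF D(1,2)[OF that]] D[OF that] by (auto simp: C_def)
  have to_pair: "bij_betw (to_pair j) (odd_mex j) {(k, p). p \<in> partitions - with_part (j + 2 * k + 1)}"
  proof (rule bij_betw_byWitness[where f' = "from_pair j"])
    show "to_pair j ` odd_mex j \<subseteq> {(k, p). p \<in> partitions - with_part (j + 2 * k + 1)}"
      by (rule image_subsetI) (rule from_pair_to_pair(1))
    show "from_pair j ` {(k, p). p \<in> partitions - with_part (j + 2 * k + 1)} \<subseteq> odd_mex j"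
      using from_pair_odd_mex by (auto simp del: from_pair.simps)
    show "\<forall>p\<in>odd_mex j. from_pair j (to_pair j p) = p"
      using from_pair_to_pair(2) by blast
    show "\<forall>x\<in>{(k, p). p \<in> partitions - with_part (j + 2 * k + 1)}. to_pair j (from_pair j x) = x"
      using to_pair_from_pair by (auto simp del: from_pair.simps)
  qed
  have phi: "let m = j + 2 * k; d = durfee m p in
      (p \<notin> fixfree m \<longrightarrow> 1 \<le> d \<and> part p d = d + m) \<and> phi j (k, p) \<in> UNIV \<times> partitions"
    if p: "p \<in> partitions" "\<not> (k = 0 \<and> p \<in> fixfree j)" for k p
  proof -
    obtain k' q' where "phi j (k, p) = (k', q')" "q' \<in> with_part (j + 2 * k' + 1)"
      using phi_inverse[OF p] by blast
    then show ?thesis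
      using part_durfee[OF p(1)] by (auto simp: Let_def with_part_def)
  qed
  have psi: "let m = j + 2 * k + 1; d = durfee m p in
      (p \<notin> fixfree m \<longrightarrow> 1 \<le> d \<and> part p d = d + m) \<and> m \<in> set (drop d p) \<and>
      psi j (k, p) \<in> UNIV \<times> partitions"
    if p: "p \<in> with_part (j + 2 * k + 1)" for k p
  proof -
    have pp: "p \<in> partitions" "j + 2 * k + 1 \<in> set p"
      using p by (auto simp: with_part_def)
    obtain k' q' where "psi j (k, p) = (k', q')" "q' \<in> partitions"
      using psi_inverse[OF p] by blast
    then show ?thesis
      using part_durfee[OF pp(1)] part_after_durfee[OF pp] by (auto simp: Let_def)
  qed
  let ?f = "Lam \<circ> Gam j \<circ> Phi j" and ?g = "Psi j \<circ> Gam_inv j \<circ> Lam"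
  have f: "?f p \<in> D" "?g (?f p) = p" "weight (?f p) = weight p" if "p \<in> A" for p
    using that Phi Gam Lam_C by simp_all
  have g: "?g q \<in> A" "?f (?g q) = q" if "q \<in> D" for q
    using that Psi Gam_inv Lam_D by simp_all
  have bij: "bij_betw ?f A D"
    by (rule bij_betw_byWitness[where f' = ?g]) (use f g in \<open>simp_all add: image_subset_iff\<close>)
  show ?thesis
  proof (intro conjI)
    show "\<forall>p\<in>B. (j \<noteq> 0 \<longrightarrow> j \<in> set (drop (durfee j p) p)) \<and> Gam j p \<in> partitions"
      using Gam_props(1,2)[OF B'] by blast
    show "\<forall>p\<in>C. (let d = durfee j p; n = d + j in
        d + n \<le> length p \<and> (\<forall>x \<in> set (drop (length p - n) p). x = 1)) \<and>
        Gam_inv j p \<in> partitions"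
    proof
      fix p assume p: "p \<in> C"
      show "(let d = durfee j p; n = d + j in
        d + n \<le> length p \<and> (\<forall>x \<in> set (drop (length p - n) p). x = 1)) \<and>
        Gam_inv j p \<in> partitions"
        using Gam_inv_props(1-3)[OF C[OF p]] by (simp add: Let_def fixfree_def mult_2 add.assoc)
    qed
    show "\<forall>p\<in>odd_mex j. from_pair j (to_pair j p) = p"
      using from_pair_to_pair(2) by blast
    show "\<forall>p\<in>odd_mex j. Phi_run j p \<noteq> None \<and> Phi j p \<in> fixfree j"
      using Phi_props(1,2) by blast
    show "\<forall>p\<in>fixfree j. Psi_run j p \<noteq> None \<and> Psi j p \<in> odd_mex j"
      using Psi_props(1,2) by blast
    show "\<forall>p\<in>partitions. 1 < weight p \<longrightarrow> Lam p \<in> partitions"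
      using Lam_props(1) by blast
  qed (use to_pair phi psi Phi(1) Psi(1) Gam(1) Gam_inv(1) Lam_C(1) Lam_D(1) bij f g in
      \<open>simp_all add: image_subset_iff\<close>)
qed

end
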